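(* Let $n\ge1$, $\alpha\in\mathbb{R}\setminus\pi\mathbb{Z}$ and $1\le p,q\le\infty$. If a classical operator $S$ is bounded from $L^p(\mathbb{R}^n)$ to $L^q(\mathbb{R}^n)$ (respectively, for $q<\infty$, from $L^p(\mathbb{R}^n)$ to $L^{q,\infty}(\mathbb{R}^n)$), then $$S_\alpha:=\mathcal F_\alpha^{-1}S\mathcal F_\alpha$$ is bounded from $L^p_\alpha(\mathbb{R}^n)$ to $L^q_\alpha(\mathbb{R}^n)$ (respectively from $L^p_\alpha(\mathbb{R}^n)$ to $L^{q,\infty}_\alpha(\mathbb{R}^n)$), with the same operator norm.
   Context: Let $\widehat f(\xi)=\int_{\mathbb{R}^n}e^{-2\pi ix\cdot\xi}f(x)\,dx$ and $M_\alpha f(x)=e^{\pi i|x|^2\cot\alpha}f(x)$. The fractional Fourier transform is $$(\mathcal F_\alpha f)(\xi)=c_{\alpha,n}|\sin\alpha|^{-n/2}e^{\pi i|\xi|^2\cot\alpha}\,\widehat{M_\alpha f}(\xi/\sin\alpha),$$ with $c_{\alpha,n}$ a fixed constant of modulus one; it is extended to a bijection of $\mathcal S'(\mathbb{R}^n)$. The pullback spaces are, for $1\le r\le\infty$, $$L^r_\alpha(\mathbb{R}^n):=\{f\in\mathcal S'(\mathbb{R}^n):\mathcal F_\alpha f\in L^r(\mathbb{R}^n)\},\qquad\|f\|_{L^r_\alpha}:=\|\mathcal F_\alpha f\|_{L^r},$$ and, for $1\le r<\infty$, $$L^{r,\infty}_\alpha(\mathbb{R}^n):=\{f\in\mathcal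 S'(\mathbb{R}^n):\mathcal F_\alpha f\in L^{r,\infty}(\mathbb{R}^n)\},\qquad\|f\|_{L^{r,\infty}_\alpha}:=\|\mathcal F_\alpha f\|_{L^{r,\infty}}.$$ Here $L^{r,\infty}$ is the weak $L^r$ space.
   Formalization: For q = 1 in the weak-type case, S is required to take values in those L^{1,∞} functions that define tempered distributions by integration; otherwise F_α^{-1}S F_α is undefined (e.g. the maximal function of an L^1 function need not be locally integrable). *)

theory Defs
  imports "HOL-Analysis.Analysis" "HOL-Probability.Essential_Supremum"
begin

section \<open>Schwartz functions and tempered distributions\<close>

definition partial_deriv :: "'n::finite \<Rightarrow> (real^'n \<Rightarrow> complex) \<Rightarrow> real^'n \<Rightarrow> complex" where
  "partial_deriv i f = (\<lambda>x. frechet_derivative f (at x) (axis i 1))"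

primrec iter_partial :: "'n::finite list \<Rightarrow> (real^'n \<Rightarrow> complex) \<Rightarrow> real^'n \<Rightarrow> complex" where
  "iter_partial [] f = f"
| "iter_partial (i # is) f = partial_deriv i (iter_partial is f)"

definition smooth_fun :: "(real^'n::finite \<Rightarrow> complex) \<Rightarrow> bool" where
  "smooth_fun f \<longleftrightarrow> (\<forall>is x. iter_partial is f differentiable (at x))"

definition schwartz_space :: "(real^'n::finite \<Rightarrow> complex) set" where
  "schwartz_space = {f. smooth_fun f \<and>
     (\<forall>k is. bdd_above (range (\<lambda>x. (1 + norm x) ^ k * cmod (iter_partial is f x))))}"

definition schwartz_seminorm :: "nat \<Rightarrow> 'n::finite list \<Rightarrow> (real^'n \<Rightarrow> complex) \<Rightarrow> real" where
  "schwartz_seminorm k is f = (SUP x. (1 + norm x) ^ k * cmod (iter_partial is f x))"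

type_synonym 'n functional = "(real^'n \<Rightarrow> complex) \<Rightarrow> complex"

text \<open>A tempered distribution is a continuous linear functional on the Schwartz space. As a HOL
  function it also has values at arguments outside the Schwartz space; extensionality pins these
  down, so that equality in HOL is equality of distributions.\<close>

definition tempered_distributions :: "'n::finite functional set" where
  "tempered_distributions = {u \<in> extensional schwartz_space.
     (\<forall>\<phi>\<in>schwartz_space. \<forall>\<psi>\<in>schwartz_space. u (\<lambda>x. \<phi> x + \<psi> x) = u \<phi> + u \<psi>) \<and>
     (\<forall>a. \<forall>\<phi>\<in>schwartz_space. u (\<lambda>x. a * \<phi> x) = a * u \<phi>) \<and>
     (\<exists>C N. \<forall>\<phi>\<in>schwartz_space.
        cmod (u \<phi>) \<le> C * (\<Sum>is | length is \<le> N. schwartz_seminorm N is \<phi>))}"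

section \<open>The fractional Fourier transform\<close>

definition fourier :: "(real^'n::finite \<Rightarrow> complex) \<Rightarrow> real^'n \<Rightarrow> complex" where
  "fourier f \<xi> = (LINT x|lborel. cis (- 2 * pi * (x \<bullet> \<xi>)) * f x)"

definition chirp :: "real \<Rightarrow> (real^'n::finite \<Rightarrow> complex) \<Rightarrow> real^'n \<Rightarrow> complex" where
  "chirp \<alpha> f x = cis (pi * (norm x)\<^sup>2 * cot \<alpha>) * f x"

text \<open>The parameter \<open>c\<close> is the unimodular constant of the transform.\<close>

definition frft :: "complex \<Rightarrow> real \<Rightarrow> (real^'n::finite \<Rightarrow> complex) \<Rightarrow> real^'n \<Rightarrow> complex" where
  "frft c \<alpha> f \<xi> = c * of_real (\<bar>sin \<alpha>\<bar> powr (- real CARD('n) / 2))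
     * cis (pi * (norm \<xi>)\<^sup>2 * cot \<alpha>) * fourier (chirp \<alpha> f) (\<xi> /\<^sub>R sin \<alpha>)"

text \<open>The kernel of \<^const>\<open>frft\<close> is symmetric in its two variables, so that
  \<open>\<integral> (frft c \<alpha> f) * \<phi> = \<integral> f * (frft c \<alpha> \<phi>)\<close>; hence the extension to tempered distributions
  acts by the same transform on the test function.\<close>

definition frft_dist :: "complex \<Rightarrow> real \<Rightarrow> 'n::finite functional \<Rightarrow> 'n functional" where
  "frft_dist c \<alpha> u = (\<lambda>\<phi>\<in>schwartz_space. u (frft c \<alpha> \<phi>))"

definition frft_dist_inv :: "complex \<Rightarrow> real \<Rightarrow> 'n::finite functional \<Rightarrow> 'n functional" where
  "frft_dist_inv c \<alpha> = the_inv_into tempered_distributions (frft_dist c \<alpha>)"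

section \<open>Lebesgue and weak Lebesgue spaces\<close>

definition Lp_functions :: "ennreal \<Rightarrow> (real^'n::finite \<Rightarrow> complex) set" where
  "Lp_functions p = {g \<in> borel_measurable lborel.
     if p = \<infinity> then (\<exists>C. AE x in lborel. cmod (g x) \<le> C)
     else integrable lborel (\<lambda>x. cmod (g x) powr enn2real p)}"

definition Lp_fun_norm :: "ennreal \<Rightarrow> (real^'n::finite \<Rightarrow> complex) \<Rightarrow> real" where
  "Lp_fun_norm p g =
     (if p = \<infinity> then real_of_ereal (esssup lborel (\<lambda>x. ereal (cmod (g x))))
      else (LINT x|lborel. cmod (g x) powr enn2real p) powr (1 / enn2real p))"

definition weak_Lp_functions :: "real \<Rightarrow> (real^'n::finite \<Rightarrow> complex) set" where
  "weak_Lp_functions r = {g \<in> borel_measurable lborel.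
     (\<forall>t>0. emeasure lborel {x. t < cmod (g x)} < \<infinity>) \<and>
     bdd_above ((\<lambda>t. t * measure lborel {x. t < cmod (g x)} powr (1 / r)) ` {0<..})}"

definition weak_Lp_fun_norm :: "real \<Rightarrow> (real^'n::finite \<Rightarrow> complex) \<Rightarrow> real" where
  "weak_Lp_fun_norm r g = (SUP t\<in>{0<..}. t * measure lborel {x. t < cmod (g x)} powr (1 / r))"

text \<open>Functions, identified when equal almost everywhere, are regarded as tempered distributions
  by integration. The function representing a distribution is unique up to null sets, so the norms
  of distributions below do not depend on the chosen representative.\<close>

definition represents :: "(real^'n::finite \<Rightarrow> complex) \<Rightarrow> 'n functional \<Rightarrow> bool" where
  "represents g u \<longleftrightarrow> g \<in> borel_measurable lborel \<and>
     (\<forall>\<phi>\<in>schwartz_space. integrable lborel (\<lambda>x. g x * \<phi> x) \<and> u \<phi> = (LINT x|lborel. g x * \<phi> x))"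

definition function_of :: "'n::finite functional \<Rightarrow> (real^'n \<Rightarrow> complex)" where
  "function_of u = (SOME g. represents g u)"

definition Lp :: "ennreal \<Rightarrow> 'n::finite functional set" where
  "Lp p = {u \<in> tempered_distributions. \<exists>g \<in> Lp_functions p. represents g u}"

definition Lp_norm :: "ennreal \<Rightarrow> 'n::finite functional \<Rightarrow> real" where
  "Lp_norm p u = Lp_fun_norm p (function_of u)"

text \<open>Every function in weak \<open>L\<^sup>r\<close> is a tempered distribution if \<open>r > 1\<close>. Functions in weak
  \<open>L\<^sup>1\<close> need not be locally integrable; those which define no tempered distribution are
  necessarily left out here.\<close>

definition weak_Lp :: "real \<Rightarrow> 'n::finite functional set" where
  "weak_Lp r = {u \<in> tempered_distributions. \<exists>g \<in> weak_Lp_functions r. represents g u}"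

definition weak_Lp_norm :: "real \<Rightarrow> 'n::finite functional \<Rightarrow> real" where
  "weak_Lp_norm r u = weak_Lp_fun_norm r (function_of u)"

definition Lp_pullback :: "complex \<Rightarrow> real \<Rightarrow> ennreal \<Rightarrow> 'n::finite functional set" where
  "Lp_pullback c \<alpha> p = {f \<in> tempered_distributions. frft_dist c \<alpha> f \<in> Lp p}"

definition Lp_pullback_norm :: "complex \<Rightarrow> real \<Rightarrow> ennreal \<Rightarrow> 'n::finite functional \<Rightarrow> real" where
  "Lp_pullback_norm c \<alpha> p f = Lp_norm p (frft_dist c \<alpha> f)"

definition weak_Lp_pullback :: "complex \<Rightarrow> real \<Rightarrow> real \<Rightarrow> 'n::finite functional set" where
  "weak_Lp_pullback c \<alpha> r = {f \<in> tempered_distributions. frft_dist c \<alpha> f \<in> weak_Lp r}"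

definition weak_Lp_pullback_norm :: "complex \<Rightarrow> real \<Rightarrow> real \<Rightarrow> 'n::finite functional \<Rightarrow> real" where
  "weak_Lp_pullback_norm c \<alpha> r f = weak_Lp_norm r (frft_dist c \<alpha> f)"

section \<open>Bounded operators\<close>

text \<open>Operators between (quasi-)normed spaces given by a carrier and a norm. Linearity is not
  required, so that sublinear operators such as maximal functions are covered.\<close>

definition bounded_operator ::
    "'a set \<Rightarrow> ('a \<Rightarrow> real) \<Rightarrow> 'b set \<Rightarrow> ('b \<Rightarrow> real) \<Rightarrow> ('a \<Rightarrow> 'b) \<Rightarrow> bool" where
  "bounded_operator X nX Y nY T \<longleftrightarrow>
     (\<forall>f\<in>X. T f \<in> Y) \<and> (\<exists>C. \<forall>f\<in>X. nY (T f) \<le> C * nX f)"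

definition operator_norm :: "'a set \<Rightarrow> ('a \<Rightarrow> real) \<Rightarrow> ('b \<Rightarrow> real) \<Rightarrow> ('a \<Rightarrow> 'b) \<Rightarrow> real" where
  "operator_norm X nX nY T = Inf {C. 0 \<le> C \<and> (\<forall>f\<in>X. nY (T f) \<le> C * nX f)}"

definition frac_operator ::
    "complex \<Rightarrow> real \<Rightarrow> ('n::finite functional \<Rightarrow> 'n functional) \<Rightarrow> 'n functional \<Rightarrow> 'n functional" where
  "frac_operator c \<alpha> S = frft_dist_inv c \<alpha> \<circ> S \<circ> frft_dist c \<alpha>"

end

theory Submission
  imports Defs "HOL-Probability.Characteristic_Functions" "HOL-Probability.Sinc_Integral"
begin

text \<open>Conjugation by a bijection that carries the pullback norms to the original norms preserves
  boundedness and operator norms, so everything rests on the fractional Fourier transform being a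
  bijection of the tempered distributions. By duality this follows once it is a continuous bijection
  of the Schwartz space. It is composed of a chirp multiplication, the Fourier transform, a dilation
  and another chirp multiplication, each of which is continuous on the Schwartz space; its inverse is
  the transform with parameters \<open>-\<alpha>\<close> and \<open>cnj c\<close>, by Fourier inversion, which is proved by Gaussian
  regularization.\<close>

section \<open>Iterated partial derivatives\<close>

text \<open>A tempered distribution comes with a seminorm estimate, so bijectivity of the transform
  on test functions is not enough: the transform must also carry estimates to estimates. The
  obstacle is that \<open>schwartz_seminorm\<close> is a real supremum, which says nothing until it
  is known to be finite; membership in the Schwartz space and continuity are therefore read off
  together from pointwise weighted bounds. Closed formulas for iterated derivatives are avoided
  throughout. Only one derivative at a time is pushed through an operator (the innermost one for
  products, the outermost one for Fourier transforms), and the remaining ones are absorbed by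
  composing operators already known to be continuous. The dual pairing then turns the inversion
  formula for test functions into one for distributions, with the order of the two transforms
  exchanged.\<close>

lemma partial_deriv_eq:
  assumes "(f has_derivative f') (at x)"
  shows "partial_deriv i f x = f' (axis i 1)"
  using frechet_derivative_at[OF assms] by (simp add: partial_deriv_def)

lemma iter_partial_append: "iter_partial (is @ js) f = iter_partial is (iter_partial js f)"
  by (induction "is") auto

lemma smooth_fun_differentiable: "smooth_fun f \<Longrightarrow> f differentiable (at x)"
  unfolding smooth_fun_def by (metis iter_partial.simps(1))

lemma smooth_fun_partial_deriv: "smooth_fun f \<Longrightarrow> smooth_fun (partial_deriv i f)"
  unfolding smooth_fun_def
  by (metis iter_partial_append iter_partial.simps)

lemma smooth_fun_continuous: "smooth_fun f \<Longrightarrow> continuous_on UNIV f"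
  by (simp add: smooth_fun_differentiable continuous_on_eq_continuous_at differentiable_imp_continuous_within)

lemma partial_deriv_add:
  assumes "f differentiable (at x)" "g differentiable (at x)"
  shows "partial_deriv i (\<lambda>x. f x + g x) x = partial_deriv i f x + partial_deriv i g x"
  using partial_deriv_eq[OF has_derivative_add[OF assms[unfolded frechet_derivative_works]]]
  by (simp add: partial_deriv_def)

lemma partial_deriv_mult:
  assumes "f differentiable (at x)" "g differentiable (at x)"
  shows "partial_deriv i (\<lambda>x. f x * g x) x = partial_deriv i f x * g x + f x * partial_deriv i g x"
  using partial_deriv_eq[OF has_derivative_mult[OF assms[unfolded frechet_derivative_works]]]
  by (simp add: partial_deriv_def)

text \<open>Splitting a derivative of order n over a sum only uses differentiability of the
  derivatives of lower order. The hypotheses stop there so that the rule is available inside the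
  induction that proves products smooth, where higher orders are still open.\<close>

lemma iter_partial_add:
  assumes "\<And>js x. length js < length is \<Longrightarrow> iter_partial js f differentiable (at x)"
    and "\<And>js x. length js < length is \<Longrightarrow> iter_partial js g differentiable (at x)"
  shows "iter_partial is (\<lambda>x. f x + g x) = (\<lambda>x. iter_partial is f x + iter_partial is g x)"
  using assms
proof (induction "is")
  case (Cons i js)
  then have "iter_partial js (\<lambda>x. f x + g x) = (\<lambda>x. iter_partial js f x + iter_partial js g x)"
    by simp
  then show ?case
    using Cons.prems[of js] by (auto intro!: partial_deriv_add)
qed auto

lemma smooth_fun_add:
  assumes "smooth_fun f" "smooth_fun g"
  shows "smooth_fun (\<lambda>x. f x + g x)"
  using assms unfolding smooth_fun_def by (auto simp: iter_partial_add)

section \<open>Continuous operators on the Schwartz space\<close>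

text \<open>This is the quantity in the continuity condition for tempered distributions. On Schwartz
  functions it increases with \<open>N\<close>, so one index can replace finitely many.\<close>

definition total_seminorm :: "nat \<Rightarrow> (real^'n::finite \<Rightarrow> complex) \<Rightarrow> real" where
  "total_seminorm N f = (\<Sum>is | length is \<le> N. schwartz_seminorm N is f)"

lemma schwartz_space_smooth: "f \<in> schwartz_space \<Longrightarrow> smooth_fun f"
  by (simp add: schwartz_space_def)

lemma schwartz_seminorm_upper:
  assumes "f \<in> schwartz_space"
  shows "(1 + norm x) ^ k * cmod (iter_partial is f x) \<le> schwartz_seminorm k is f"
  unfolding schwartz_seminorm_def using assms
  by (intro cSUP_upper) (auto simp: schwartz_space_def)

lemma schwartz_seminorm_least:
  assumes "\<And>x. (1 + norm x) ^ k * cmod (iter_partial is f x) \<le> B"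
  shows "schwartz_seminorm k is f \<le> B"
  unfolding schwartz_seminorm_def using assms by (intro cSUP_least) auto

lemma schwartz_seminorm_nonneg: "f \<in> schwartz_space \<Longrightarrow> 0 \<le> schwartz_seminorm k is f"
  by (rule order_trans[OF _ schwartz_seminorm_upper[where x=0]]) auto

lemma schwartz_seminorm_mono:
  assumes "f \<in> schwartz_space" "k \<le> l"
  shows "schwartz_seminorm k is f \<le> schwartz_seminorm l is f"
proof (rule schwartz_seminorm_least)
  fix x
  have "(1 + norm x) ^ k * cmod (iter_partial is f x) \<le> (1 + norm x) ^ l * cmod (iter_partial is f x)"
    using assms by (intro mult_right_mono power_increasing) auto
  also have "\<dots> \<le> schwartz_seminorm l is f" by (rule schwartz_seminorm_upper[OF assms(1)])
  finally show "(1 + norm x) ^ k * cmod (iter_partial is f x) \<le> schwartz_seminorm l is f" .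
qed

lemma finite_length_le: "finite {is :: 'a::finite list. length is \<le> N}"
  using finite_lists_length_le[of "UNIV :: 'a set" N] by simp

lemma total_seminorm_mono:
  assumes "f \<in> schwartz_space" "N \<le> M"
  shows "total_seminorm N f \<le> total_seminorm M f"
proof -
  have "total_seminorm N f \<le> (\<Sum>is | length is \<le> N. schwartz_seminorm M is f)"
    unfolding total_seminorm_def by (intro sum_mono schwartz_seminorm_mono assms)
  also have "\<dots> \<le> total_seminorm M f"
    unfolding total_seminorm_def using assms
    by (intro sum_mono2) (auto simp: schwartz_seminorm_nonneg finite_length_le)
  finally show ?thesis .
qed

lemma total_seminorm_nonneg: "f \<in> schwartz_space \<Longrightarrow> 0 \<le> total_seminorm N f"
  unfolding total_seminorm_def by (intro sum_nonneg schwartz_seminorm_nonneg)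

lemma schwartz_seminorm_le_total:
  assumes "f \<in> schwartz_space"
  shows "schwartz_seminorm k is f \<le> total_seminorm (max k (length is)) f"
proof -
  have "schwartz_seminorm k is f \<le> schwartz_seminorm (max k (length is)) is f"
    by (intro schwartz_seminorm_mono assms) auto
  also have "\<dots> \<le> total_seminorm (max k (length is)) f"
    unfolding total_seminorm_def using assms
    by (intro member_le_sum) (auto simp: schwartz_seminorm_nonneg finite_length_le)
  finally show ?thesis .
qed

text \<open>The bound is uniform in the parameter \<open>y\<close>, so that it can be applied to weighted pointwise
  values before the finiteness of their supremum is known.\<close>

definition seminorm_bounded :: "((real^'n::finite \<Rightarrow> complex) \<Rightarrow> 'b \<Rightarrow> real) \<Rightarrow> bool" where
  "seminorm_bounded R \<longleftrightarrow> (\<exists>C N. \<forall>f\<in>schwartz_space. \<forall>y. R f y \<le> C * total_seminorm N f)"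

text \<open>Total seminorms are nonnegative, so \<open>C\<close> may be replaced by its absolute
  value; a nonnegative constant is what allows \<open>N\<close> to be enlarged later.\<close>

lemma seminorm_boundedE:
  assumes "seminorm_bounded R"
  obtains C N where "0 \<le> C" "\<And>f y. f \<in> schwartz_space \<Longrightarrow> R f y \<le> C * total_seminorm N f"
proof -
  obtain C N where *: "\<And>f y. f \<in> schwartz_space \<Longrightarrow> R f y \<le> C * total_seminorm N f"
    using assms unfolding seminorm_bounded_def by blast
  have "R f y \<le> \<bar>C\<bar> * total_seminorm N f" if "f \<in> schwartz_space" for f y
    using *[OF that, of y] mult_right_mono[OF abs_ge_self total_seminorm_nonneg[OF that], of C N] by linarith
  then show thesis using that[of "\<bar>C\<bar>" N] by auto
qed

lemma seminorm_boundedI: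
  assumes "\<And>f y. f \<in> schwartz_space \<Longrightarrow> R f y \<le> C * total_seminorm N f"
  shows "seminorm_bounded R"
  using assms unfolding seminorm_bounded_def by blast

text \<open>The point \<open>z\<close> may differ from \<open>y\<close>, and even its type may: a
  dilation compares the value at \<open>x\<close> with one at \<open>r *\<^sub>R x\<close>.\<close>

lemma seminorm_bounded_mono:
  assumes "seminorm_bounded R" "\<And>f y. f \<in> schwartz_space \<Longrightarrow> \<exists>z. Q f y \<le> R f z"
  shows "seminorm_bounded Q"
  using assms unfolding seminorm_bounded_def by (meson order_trans)

lemma seminorm_bounded_add:
  assumes "seminorm_bounded R" "seminorm_bounded Q"
  shows "seminorm_bounded (\<lambda>f y. R f y + Q f y)"
proof -
  obtain C N where 1: "0 \<le> C" "\<And>f y. f \<in> schwartz_space \<Longrightarrow> R f y \<le> C * total_seminorm N f"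
    using seminorm_boundedE[OF assms(1)] by metis
  obtain D M where 2: "0 \<le> D" "\<And>f y. f \<in> schwartz_space \<Longrightarrow> Q f y \<le> D * total_seminorm M f"
    using seminorm_boundedE[OF assms(2)] by metis
  show ?thesis
  proof (rule seminorm_boundedI[where C="C + D" and N="max N M"])
    fix f :: "real^'a \<Rightarrow> complex" and y assume f: "f \<in> schwartz_space"
    have "C * total_seminorm N f \<le> C * total_seminorm (max N M) f"
      "D * total_seminorm M f \<le> D * total_seminorm (max N M) f"
      using f 1(1) 2(1) by (auto intro!: mult_left_mono total_seminorm_mono)
    then show "R f y + Q f y \<le> (C + D) * total_seminorm (max N M) f"
      using 1(2)[OF f, of y] 2(2)[OF f, of y] by (simp add: distrib_right)
  qed
qed

lemma seminorm_bounded_scale: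
  assumes "seminorm_bounded R" "0 \<le> c"
  shows "seminorm_bounded (\<lambda>f y. c * R f y)"
proof -
  obtain C N where "\<And>f y. f \<in> schwartz_space \<Longrightarrow> R f y \<le> C * total_seminorm N f"
    using seminorm_boundedE[OF assms(1)] by metis
  then show ?thesis
    by (intro seminorm_boundedI[where C="c * C" and N=N])
       (use assms(2) in \<open>auto simp: mult.assoc intro!: mult_left_mono\<close>)
qed

lemma seminorm_bounded_zero: "seminorm_bounded (\<lambda>f y. 0)"
  by (rule seminorm_boundedI[where C=0]) auto

lemma seminorm_bounded_sum:
  assumes "finite I" "\<And>i. i \<in> I \<Longrightarrow> seminorm_bounded (R i)"
  shows "seminorm_bounded (\<lambda>f y. \<Sum>i\<in>I. R i f y)"
  using assms by (induction I) (auto intro: seminorm_bounded_add seminorm_bounded_zero)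

text \<open>Smoothness and the pointwise bounds together express that the Schwartz space is mapped
  into itself and that the map is continuous there; linearity is treated separately.\<close>

definition schwartz_continuous ::
    "((real^'n::finite \<Rightarrow> complex) \<Rightarrow> real^'n \<Rightarrow> complex) \<Rightarrow> bool" where
  "schwartz_continuous T \<longleftrightarrow> (\<forall>f\<in>schwartz_space. smooth_fun (T f)) \<and>
     (\<forall>k is. seminorm_bounded (\<lambda>f x. (1 + norm x) ^ k * cmod (iter_partial is (T f) x)))"

lemma schwartz_continuous_in:
  assumes "schwartz_continuous T" "f \<in> schwartz_space"
  shows "T f \<in> schwartz_space"
  unfolding schwartz_space_def mem_Collect_eq
proof (intro conjI allI)
  show "smooth_fun (T f)" using assms by (auto simp: schwartz_continuous_def)
  fix k "is"
  have "seminorm_bounded (\<lambda>f x. (1 + norm x) ^ k * cmod (iter_partial is (T f) x))"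
    using assms by (auto simp: schwartz_continuous_def)
  then obtain C N where "0 \<le> C" and C:
    "\<And>f x. f \<in> schwartz_space \<Longrightarrow>
      (1 + norm x) ^ k * cmod (iter_partial is (T f) x) \<le> C * total_seminorm N f"
    by (rule seminorm_boundedE) blast
  from C[OF assms(2)] show "bdd_above (range (\<lambda>x. (1 + norm x) ^ k * cmod (iter_partial is (T f) x)))"
    by (intro bdd_aboveI[where M="C * total_seminorm N f"]) auto
qed

lemma schwartz_continuous_seminorm:
  fixes T :: "(real^'n::finite \<Rightarrow> complex) \<Rightarrow> real^'n \<Rightarrow> complex"
  assumes "schwartz_continuous T"
  shows "seminorm_bounded (\<lambda>f (y::'b). schwartz_seminorm k is (T f))"
proof -
  have "seminorm_bounded (\<lambda>f x. (1 + norm x) ^ k * cmod (iter_partial is (T f) x))"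
    using assms by (auto simp: schwartz_continuous_def)
  then obtain C N where "0 \<le> C" and
    "\<And>f x. f \<in> schwartz_space \<Longrightarrow>
      (1 + norm x) ^ k * cmod (iter_partial is (T f) x) \<le> C * total_seminorm N f"
    by (rule seminorm_boundedE) blast
  then show ?thesis
    by (intro seminorm_boundedI[where C=C and N=N] schwartz_seminorm_least) auto
qed

text \<open>There are finitely many index lists of bounded length, so the total seminorm of
  \<open>T f\<close> is a finite sum of quantities each controlled by a total seminorm of
  \<open>f\<close>.\<close>

lemma seminorm_bounded_compose:
  assumes "seminorm_bounded R" "schwartz_continuous T"
  shows "seminorm_bounded (\<lambda>f. R (T f))"
proof -
  obtain C N where C: "0 \<le> C" "\<And>f y. f \<in> schwartz_space \<Longrightarrow> R f y \<le> C * total_seminorm N f"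
    using seminorm_boundedE[OF assms(1)] by metis
  have "seminorm_bounded (\<lambda>f (y::'b). C * total_seminorm N (T f))"
    unfolding total_seminorm_def
    by (intro seminorm_bounded_scale seminorm_bounded_sum schwartz_continuous_seminorm assms C
        finite_length_le)
  then show ?thesis
    by (rule seminorm_bounded_mono) (use C(2) schwartz_continuous_in[OF assms(2)] in blast)
qed

lemma schwartz_continuous_compose:
  assumes "schwartz_continuous T" "schwartz_continuous U"
  shows "schwartz_continuous (\<lambda>f. T (U f))"
  unfolding schwartz_continuous_def
proof (intro conjI ballI allI)
  show "smooth_fun (T (U f))" if "f \<in> schwartz_space" for f
    using assms that schwartz_continuous_in by (auto simp: schwartz_continuous_def)
  fix k "is"
  show "seminorm_bounded (\<lambda>f x. (1 + norm x) ^ k * cmod (iter_partial is (T (U f)) x))"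
    using assms seminorm_bounded_compose[OF _ assms(2),
        of "\<lambda>f x. (1 + norm x) ^ k * cmod (iter_partial is (T f) x)"]
    by (auto simp: schwartz_continuous_def)
qed

lemma seminorm_bounded_pointwise:
  "seminorm_bounded (\<lambda>f x. (1 + norm x) ^ k * cmod (iter_partial is f x))"
  using schwartz_seminorm_upper schwartz_seminorm_le_total
  by (intro seminorm_boundedI[where C=1 and N="max k (length is)"]) (fastforce intro: order_trans)

lemma schwartz_continuous_partial_deriv: "schwartz_continuous (partial_deriv i)"
  unfolding schwartz_continuous_def
proof (intro conjI ballI allI)
  fix k and "is" :: "'a list"
  show "seminorm_bounded (\<lambda>f x. (1 + norm x) ^ k * cmod (iter_partial is (partial_deriv i f) x))"
    \<comment> \<open>The end of the list is the derivative applied first, so the additional one is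
      appended.\<close>
    using seminorm_bounded_pointwise[of k "is @ [i]"] by (simp add: iter_partial_append)
qed (simp add: smooth_fun_partial_deriv schwartz_space_smooth)

section \<open>Multiplication operators\<close>

text \<open>A condition on a family closed under differentiation replaces growth bounds for all
  derivatives of a single function: closure can be checked one derivative at a time.\<close>

definition schwartz_multipliers :: "(real^'n::finite \<Rightarrow> complex) set \<Rightarrow> bool" where
  "schwartz_multipliers X \<longleftrightarrow> (\<forall>m\<in>X. (\<forall>x. m differentiable (at x)) \<and>
     (\<forall>i. partial_deriv i m \<in> X) \<and> (\<exists>C k. \<forall>x. cmod (m x) \<le> C * (1 + norm x) ^ k))"

text \<open>The product rule turns one derivative of the product into two products of the same kind,
  with a derivative on either factor. Both factors change, hence the induction on the order is
  uniform over all multipliers and all smooth functions.\<close>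

lemma smooth_fun_multiplier:
  fixes m :: "real^'n::finite \<Rightarrow> complex"
  assumes X: "schwartz_multipliers X" and m: "m \<in> X" and f: "smooth_fun f"
  shows "smooth_fun (\<lambda>x. m x * f x)"
proof -
  have "\<forall>m\<in>X. \<forall>f (is :: 'n list) x. smooth_fun f \<longrightarrow> length is \<le> n \<longrightarrow>
          iter_partial is (\<lambda>x. m x * f x) differentiable (at x)"
    for n
  proof (induction n)
    case 0
    then show ?case using X by (auto simp: schwartz_multipliers_def smooth_fun_differentiable)
  next
    case (Suc n)
    show ?case
    proof (intro ballI allI impI)
      fix m f :: "real^'n \<Rightarrow> complex" and "is" :: "'n list" and x
      assume m: "m \<in> X" and f: "smooth_fun f" and l: "length is \<le> Suc n"
      show "iter_partial is (\<lambda>x. m x * f x) differentiable (at x)"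
      \<comment> \<open>Splitting off the last index applies the product rule to the product itself
        instead of to its iterated derivatives, about which nothing is known in closed form.\<close>
      proof (cases "is" rule: rev_cases)
        case Nil
        then show ?thesis using Suc.IH[rule_format, OF m f, of "[]"] by simp
      next
        case (snoc js i)
        have diff: "m differentiable (at x)" "f differentiable (at x)" for x
          using X m f by (auto simp: schwartz_multipliers_def smooth_fun_differentiable)
        have "partial_deriv i m \<in> X" "smooth_fun (partial_deriv i f)"
          using X m f smooth_fun_partial_deriv by (auto simp: schwartz_multipliers_def)
        then have IH: "iter_partial ks (\<lambda>x. partial_deriv i m x * f x) differentiable (at x)"
          "iter_partial ks (\<lambda>x. m x * partial_deriv i f x) differentiable (at x)"
          if "length ks \<le> n" for ks x
          using Suc.IH m f that by auto
        have "partial_deriv i (\<lambda>x. m x * f x) =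
              (\<lambda>x. partial_deriv i m x * f x + m x * partial_deriv i f x)"
          using partial_deriv_mult[OF diff] by auto
        then have "iter_partial is (\<lambda>x. m x * f x) =
            (\<lambda>x. iter_partial js (\<lambda>x. partial_deriv i m x * f x) x +
              iter_partial js (\<lambda>x. m x * partial_deriv i f x) x)"
          using snoc l IH by (simp add: iter_partial_append iter_partial_add)
        then show ?thesis using IH[of js] snoc l by simp
      qed
    qed
  qed
  then show ?thesis using m f unfolding smooth_fun_def by blast
qed

lemma iter_partial_multiplier:
  assumes X: "schwartz_multipliers X" and m: "m \<in> X" and f: "smooth_fun f"
  shows "iter_partial (is @ [i]) (\<lambda>x. m x * f x) =
          (\<lambda>x. iter_partial is (\<lambda>x. partial_deriv i m x * f x) x +
               iter_partial is (\<lambda>x. m x * partial_deriv i f x) x)"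
proof -
  have diff: "m differentiable (at x)" "f differentiable (at x)" for x
    using X m f by (auto simp: schwartz_multipliers_def smooth_fun_differentiable)
  have "smooth_fun (\<lambda>x. partial_deriv i m x * f x)" "smooth_fun (\<lambda>x. m x * partial_deriv i f x)"
    using smooth_fun_multiplier[OF X] X m f smooth_fun_partial_deriv[OF f]
    by (auto simp: schwartz_multipliers_def)
  moreover have "partial_deriv i (\<lambda>x. m x * f x) =
      (\<lambda>x. partial_deriv i m x * f x + m x * partial_deriv i f x)"
    using partial_deriv_mult[OF diff] by auto
  ultimately show ?thesis by (simp add: iter_partial_append iter_partial_add smooth_fun_def)
qed

lemma schwartz_continuous_multiplier:
  assumes X: "schwartz_multipliers X" and m: "m \<in> X"
  shows "schwartz_continuous (\<lambda>f x. m x * f x)"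
  unfolding schwartz_continuous_def
proof (intro conjI ballI allI)
  show "smooth_fun (\<lambda>x. m x * f x)" if "f \<in> schwartz_space" for f
    using smooth_fun_multiplier[OF X m] schwartz_space_smooth that by blast
  fix k and "is" :: "'a list"
  show "seminorm_bounded (\<lambda>f x. (1 + norm x) ^ k * cmod (iter_partial is (\<lambda>x. m x * f x) x))"
    using m
  \<comment> \<open>It suffices to generalize \<open>m\<close>: the term containing
    \<open>partial_deriv i f\<close> is the induction hypothesis composed with the continuous
    operator \<open>partial_deriv i\<close>.\<close>
  proof (induction "is" arbitrary: m rule: rev_induct)
    case Nil
    obtain C l where C: "\<And>x. cmod (m x) \<le> C * (1 + norm x) ^ l"
      using X Nil unfolding schwartz_multipliers_def by blast
    have C0: "0 \<le> C" using order_trans[OF norm_ge_zero C[of 0]] by simp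
    have "seminorm_bounded (\<lambda>f x. C * ((1 + norm x) ^ (k + l) * cmod (iter_partial [] f x)))"
      by (intro seminorm_bounded_scale seminorm_bounded_pointwise C0)
    then show ?case
    proof (rule seminorm_bounded_mono)
      fix f :: "real^'a \<Rightarrow> complex" and x
      have "(1 + norm x) ^ k * (cmod (m x) * cmod (f x)) \<le>
            (1 + norm x) ^ k * ((C * (1 + norm x) ^ l) * cmod (f x))"
        by (intro mult_left_mono mult_right_mono C) auto
      then show "\<exists>z. (1 + norm x) ^ k * cmod (iter_partial [] (\<lambda>x. m x * f x) x) \<le>
            C * ((1 + norm z) ^ (k + l) * cmod (iter_partial [] f z))"
        by (intro exI[of _ x]) (simp add: norm_mult power_add mult_ac)
    qed
  next
    case (snoc i js)
    have im: "partial_deriv i m \<in> X" using X snoc.prems by (auto simp: schwartz_multipliers_def)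
    have "seminorm_bounded (\<lambda>f x.
        (1 + norm x) ^ k * cmod (iter_partial js (\<lambda>x. partial_deriv i m x * f x) x) +
        (1 + norm x) ^ k * cmod (iter_partial js (\<lambda>x. m x * partial_deriv i f x) x))"
      using seminorm_bounded_compose[OF snoc.IH[OF snoc.prems] schwartz_continuous_partial_deriv[of i]]
      by (intro seminorm_bounded_add snoc.IH[OF im])
    then show ?case
    proof (rule seminorm_bounded_mono)
      fix f :: "real^'a \<Rightarrow> complex" and x assume "f \<in> schwartz_space"
      then show "\<exists>z. (1 + norm x) ^ k * cmod (iter_partial (js @ [i]) (\<lambda>x. m x * f x) x)
        \<le> (1 + norm z) ^ k * cmod (iter_partial js (\<lambda>x. partial_deriv i m x * f x) z) +
           (1 + norm z) ^ k * cmod (iter_partial js (\<lambda>x. m x * partial_deriv i f x) z)"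
        by (intro exI[of _ x])
           (auto simp: iter_partial_multiplier[OF X snoc.prems schwartz_space_smooth]
             simp flip: distrib_left intro!: mult_left_mono norm_triangle_ineq)
    qed
  qed
qed

section \<open>Polynomials times chirps as multipliers\<close>

text \<open>The functions P(x) exp(i a |x|^2) with P a complex polynomial. Differentiating the chirp
  produces the factor 2 i a x_j, so a family closed under derivatives must contain the polynomial
  factors. For \<open>a = 0\<close> it is the set of polynomials, which also covers multiplication
  by coordinates and by scalars.\<close>

inductive_set polychirp :: "real \<Rightarrow> (real^'n::finite \<Rightarrow> complex) set" for a where
  chirp: "(\<lambda>x. cis (a * (norm x)\<^sup>2)) \<in> polychirp a"
| coord: "m \<in> polychirp a \<Longrightarrow> (\<lambda>x. of_real (x $ j) * m x) \<in> polychirp a"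
| scale: "m \<in> polychirp a \<Longrightarrow> (\<lambda>x. z * m x) \<in> polychirp a"
| add: "m \<in> polychirp a \<Longrightarrow> m' \<in> polychirp a \<Longrightarrow> (\<lambda>x. m x + m' x) \<in> polychirp a"

lemma has_derivative_chirp:
  "((\<lambda>x::real^'n. cis (a * (norm x)\<^sup>2)) has_derivative
     (\<lambda>h. 2 * \<i> * of_real (a * (x \<bullet> h)) * cis (a * (norm x)\<^sup>2))) (at x)"
proof -
  have "((\<lambda>x. a * (x \<bullet> x)) has_derivative (\<lambda>h. a * (2 * (x \<bullet> h)))) (at x)"
    by (auto intro!: derivative_eq_intros simp: inner_commute)
  then have "((\<lambda>x. \<i> * complex_of_real (a * (x \<bullet> x))) has_derivative
      (\<lambda>h. \<i> * of_real (a * (2 * (x \<bullet> h))))) (at x)"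
    by (rule has_derivative_mult_right[OF has_derivative_of_real])
  from has_derivative_compose[OF this DERIV_exp[unfolded has_field_derivative_def]]
  show ?thesis by (simp add: cis_conv_exp power2_norm_eq_inner mult_ac)
qed

lemma has_derivative_coord:
  "((\<lambda>x::real^'n. complex_of_real (x $ j)) has_derivative (\<lambda>h. of_real (h $ j))) (at x)"
  by (intro bounded_linear_imp_has_derivative bounded_linear_compose[OF bounded_linear_of_real]
      bounded_linear_vec_nth)

lemma partial_deriv_coord:
  "partial_deriv i (\<lambda>x. complex_of_real (x $ j)) x = (if i = j then 1 else 0)"
  by (simp add: partial_deriv_eq[OF has_derivative_coord] axis_def)

lemma partial_deriv_scale:
  assumes "f differentiable (at x)"
  shows "partial_deriv i (\<lambda>x. z * f x) x = z * partial_deriv i f x"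
  using partial_deriv_eq[OF has_derivative_mult_right[OF assms[unfolded frechet_derivative_works]]]
  by (simp add: partial_deriv_def)

lemma schwartz_multipliers_polychirp: "schwartz_multipliers (polychirp a :: (real^'n::finite \<Rightarrow> complex) set)"
  unfolding schwartz_multipliers_def
proof
  fix m :: "real^'n \<Rightarrow> complex" assume "m \<in> polychirp a"
  then show "(\<forall>x. m differentiable (at x)) \<and>
     (\<forall>i. partial_deriv i m \<in> polychirp a) \<and> (\<exists>C k. \<forall>x. cmod (m x) \<le> C * (1 + norm x) ^ k)"
  proof (induction rule: polychirp.induct)
    case chirp
    have "partial_deriv i (\<lambda>x::real^'n. cis (a * (norm x)\<^sup>2)) =
          (\<lambda>x. (2 * \<i> * a) * (of_real (x $ i) * cis (a * (norm x)\<^sup>2)))" for i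
      by (rule ext, subst partial_deriv_eq[OF has_derivative_chirp]) (simp add: inner_axis)
    then have "partial_deriv i (\<lambda>x::real^'n. cis (a * (norm x)\<^sup>2)) \<in> polychirp a" for i
      by (simp only:) (intro polychirp.intros)
    moreover have "(\<lambda>x::real^'n. cis (a * (norm x)\<^sup>2)) differentiable (at x)" for x
      using has_derivative_chirp unfolding differentiable_def by blast
    moreover have "\<exists>C k. \<forall>x::real^'n. cmod (cis (a * (norm x)\<^sup>2)) \<le> C * (1 + norm x) ^ k"
      by (rule exI[of _ 1], rule exI[of _ 0]) simp
    ultimately show ?case by blast
  next
    case (coord m j)
    then obtain C k where C: "\<And>x. cmod (m x) \<le> C * (1 + norm x) ^ k" by blast
    have C0: "0 \<le> C" using order_trans[OF norm_ge_zero C[of 0]] by simp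
    have d: "(\<lambda>x. complex_of_real (x $ j)) differentiable (at x)" for x :: "real^'n"
      using has_derivative_coord unfolding differentiable_def by blast
    have "partial_deriv i (\<lambda>x. of_real (x $ j) * m x) =
        (\<lambda>x. (if i = j then 1 else 0) * m x + of_real (x $ j) * partial_deriv i m x)" for i
      using coord by (auto simp: partial_deriv_mult[OF d] partial_deriv_coord)
    \<comment> \<open>The Kronecker delta from the product rule is read as a scalar, so that
      \<open>scale\<close> applies without a case split.\<close>
    then have "partial_deriv i (\<lambda>x. of_real (x $ j) * m x) \<in> polychirp a" for i
      using coord by (auto intro!: polychirp.intros(2-4)
          polychirp.scale[of m a "if i = j then 1 else 0"] simp del: if_split)
    moreover have "(\<lambda>x. of_real (x $ j) * m x) differentiable (at x)" for x
      using d coord by auto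
    moreover have "cmod (of_real (x $ j) * m x) \<le> C * (1 + norm x) ^ Suc k" for x
    proof -
      have "\<bar>x $ j\<bar> * cmod (m x) \<le> (1 + norm x) * (C * (1 + norm x) ^ k)"
        using component_le_norm_cart[of x j] C0 by (intro mult_mono C) auto
      then show ?thesis by (simp add: norm_mult mult_ac)
    qed
    ultimately show ?case by blast
  next
    case (scale m z)
    then obtain C k where C: "\<And>x. cmod (m x) \<le> C * (1 + norm x) ^ k" by blast
    have "cmod (z * m x) \<le> (cmod z * C) * (1 + norm x) ^ k" for x
      using C[of x] by (simp add: norm_mult mult.assoc mult_left_mono)
    moreover have "partial_deriv i (\<lambda>x. z * m x) = (\<lambda>x. z * partial_deriv i m x)" for i
      using scale by (auto simp: partial_deriv_scale)
    ultimately show ?case using scale by (auto intro: polychirp.intros)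
  next
    case (add m m')
    then obtain C k C' k' where C: "\<And>x. cmod (m x) \<le> C * (1 + norm x) ^ k"
      "\<And>x. cmod (m' x) \<le> C' * (1 + norm x) ^ k'" by blast
    have C0: "0 \<le> C" "0 \<le> C'"
      using order_trans[OF norm_ge_zero C(1)[of 0]] order_trans[OF norm_ge_zero C(2)[of 0]] by auto
    have "cmod (m x + m' x) \<le> (C + C') * (1 + norm x) ^ (max k k')" for x
    proof -
      have "C * (1 + norm x) ^ k \<le> C * (1 + norm x) ^ (max k k')"
        "C' * (1 + norm x) ^ k' \<le> C' * (1 + norm x) ^ (max k k')"
        using C0 by (auto intro!: mult_left_mono power_increasing)
      then show ?thesis
        using C(1)[of x] C(2)[of x] norm_triangle_ineq[of "m x" "m' x"] by (simp add: distrib_right)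
    qed
    moreover have "partial_deriv i (\<lambda>x. m x + m' x) = (\<lambda>x. partial_deriv i m x + partial_deriv i m' x)" for i
      using add by (auto simp: partial_deriv_add)
    ultimately show ?case using add by (auto intro: polychirp.intros)
  qed
qed

lemma schwartz_continuous_chirp: "schwartz_continuous (chirp \<alpha>)"
proof -
  have "schwartz_continuous (\<lambda>f x. cis ((pi * cot \<alpha>) * (norm x)\<^sup>2) * f x)"
    by (rule schwartz_continuous_multiplier[OF schwartz_multipliers_polychirp polychirp.chirp])
  also have "(\<lambda>f x. cis ((pi * cot \<alpha>) * (norm x)\<^sup>2) * f x) = chirp \<alpha>"
    by (auto simp: chirp_def fun_eq_iff mult_ac)
  finally show ?thesis .
qed

lemma schwartz_continuous_coord: "schwartz_continuous (\<lambda>f x. z * of_real (x $ j) * f x)"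
  using schwartz_continuous_multiplier[OF schwartz_multipliers_polychirp,
      OF polychirp.scale[OF polychirp.coord[OF polychirp.chirp[of 0]]]]
  by simp

lemma schwartz_continuous_scale: "schwartz_continuous (\<lambda>f x. z * f x)"
  using schwartz_continuous_multiplier[OF schwartz_multipliers_polychirp,
      OF polychirp.scale[OF polychirp.chirp[of 0]]]
  by simp

section \<open>Dilations\<close>

lemma iter_partial_dilation:
  assumes "smooth_fun f"
  shows "iter_partial is (\<lambda>x. f (r *\<^sub>R x)) = (\<lambda>x. of_real (r ^ length is) * iter_partial is f (r *\<^sub>R x))"
proof (induction "is")
  case (Cons i js)
  show ?case
  proof
    fix x
    have "(iter_partial js f has_derivative frechet_derivative (iter_partial js f) (at (r *\<^sub>R x))) (at (r *\<^sub>R x))"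
      using assms by (simp add: smooth_fun_def flip: frechet_derivative_works)
    from has_derivative_compose[where f="\<lambda>x. r *\<^sub>R x" and f'="\<lambda>x. r *\<^sub>R x" and s=UNIV, OF bounded_linear_imp_has_derivative[OF bounded_linear_scaleR_right] this]
    have "((\<lambda>x. iter_partial js f (r *\<^sub>R x)) has_derivative
        (\<lambda>h. frechet_derivative (iter_partial js f) (at (r *\<^sub>R x)) (r *\<^sub>R h))) (at x)" .
    from partial_deriv_eq[OF has_derivative_mult_right[OF this, of "of_real (r ^ length js)"], of i]
    show "iter_partial (i # js) (\<lambda>x. f (r *\<^sub>R x)) x =
        of_real (r ^ length (i # js)) * iter_partial (i # js) f (r *\<^sub>R x)"
      using linear_frechet_derivative[of "iter_partial js f" "at (r *\<^sub>R x)"] assms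
      by (simp only: iter_partial.simps Cons.IH) (simp add: partial_deriv_def linear_cmul smooth_fun_def,
          simp add: scaleR_conv_of_real)
  qed
qed auto

lemma schwartz_continuous_dilation:
  assumes "r \<noteq> 0"
  shows "schwartz_continuous (\<lambda>f x. f (r *\<^sub>R x))"
  unfolding schwartz_continuous_def
proof (intro conjI ballI allI)
  fix f :: "real^'a \<Rightarrow> complex" assume "f \<in> schwartz_space"
  then have f: "smooth_fun f" by (rule schwartz_space_smooth)
  have "(\<lambda>x. iter_partial is f (r *\<^sub>R x)) differentiable (at x)" for "is" x
    using differentiable_chain_at[of "\<lambda>x. r *\<^sub>R x" x "iter_partial is f"] f
    by (auto simp: smooth_fun_def o_def)
  then show "smooth_fun (\<lambda>x. f (r *\<^sub>R x))"
    unfolding smooth_fun_def iter_partial_dilation[OF f] by auto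
next
  fix k and "is" :: "'a list"
  \<comment> \<open>The first factor pays for 1 + |x| \<le> (1 + 1/|r|) (1 + |r x|) when the weight
    is moved to the point r x; the second is the chain rule factor.\<close>
  define D where "D = (1 + \<bar>inverse r\<bar>) ^ k * \<bar>r\<bar> ^ length is"
  have "seminorm_bounded (\<lambda>f x. D * ((1 + norm x) ^ k * cmod (iter_partial is f (x::real^'a))))"
    by (intro seminorm_bounded_scale seminorm_bounded_pointwise) (simp add: D_def)
  then show "seminorm_bounded (\<lambda>f x. (1 + norm x) ^ k * cmod (iter_partial is (\<lambda>x. f (r *\<^sub>R x)) (x::real^'a)))"
  proof (rule seminorm_bounded_mono)
    fix f :: "real^'a \<Rightarrow> complex" and x :: "real^'a" assume f: "f \<in> schwartz_space"
    have "1 + norm x \<le> (1 + \<bar>inverse r\<bar>) * (1 + norm (r *\<^sub>R x))"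
      using assms by (simp add: field_simps)
    then have "(1 + norm x) ^ k \<le> (1 + \<bar>inverse r\<bar>) ^ k * (1 + norm (r *\<^sub>R x)) ^ k"
      by (simp flip: power_mult_distrib add: power_mono)
    then have "(1 + norm x) ^ k * (\<bar>r\<bar> ^ length is * cmod (iter_partial is f (r *\<^sub>R x))) \<le>
        ((1 + \<bar>inverse r\<bar>) ^ k * (1 + norm (r *\<^sub>R x)) ^ k) * (\<bar>r\<bar> ^ length is * cmod (iter_partial is f (r *\<^sub>R x)))"
      by (rule mult_right_mono) auto
    then show "\<exists>z. (1 + norm x) ^ k * cmod (iter_partial is (\<lambda>x. f (r *\<^sub>R x)) x) \<le>
        D * ((1 + norm z) ^ k * cmod (iter_partial is f z))"
      by (intro exI[of _ "r *\<^sub>R x"])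
         (simp add: iter_partial_dilation[OF schwartz_space_smooth[OF f]] norm_mult norm_power D_def mult_ac power_abs)
  qed
qed

section \<open>Lebesgue integration on Euclidean space\<close>

text \<open>One substitution rule serves the translation of a function (\<open>c = 1\<close>), the
  rescaling of Gaussians (\<open>t = 0\<close>) and the combined change of variables in the Gaussian
  mean.\<close>

lemma lborel_integral_affine:
  fixes f :: "'a::euclidean_space \<Rightarrow> 'b::{banach, second_countable_topology}"
  assumes [measurable]: "f \<in> borel_measurable borel" and "c \<noteq> 0"
  shows "(LINT x|lborel. f x) = \<bar>c\<bar> ^ DIM('a) *\<^sub>R (LINT x|lborel. f (t + c *\<^sub>R x))"
proof -
  have "(LINT x|lborel. f x) =
      (LINT x|density (distr lborel borel (\<lambda>x. t + c *\<^sub>R x)) (\<lambda>_. \<bar>c\<bar> ^ DIM('a)). f x)"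
    using lborel_affine[OF assms(2), of t] by simp
  also have "\<dots> = \<bar>c\<bar> ^ DIM('a) *\<^sub>R (LINT x|lborel. f (t + c *\<^sub>R x))"
    by (subst integral_density) (auto simp: integral_distr)
  finally show ?thesis .
qed

text \<open>Lebesgue measure on a Euclidean space is the image of the product of one-dimensional
  Lebesgue measures. This reduces both the integrable majorant and the Gaussian to the real
  line.\<close>

lemma
  fixes f :: "'a::euclidean_space \<Rightarrow> real \<Rightarrow> 'b::{real_normed_field, banach, second_countable_topology}"
  assumes f: "\<And>b. b \<in> Basis \<Longrightarrow> integrable lborel (f b)"
  shows integrable_lborel_prod: "integrable lborel (\<lambda>x. \<Prod>b\<in>Basis. f b (x \<bullet> b))"
    and integral_lborel_prod:
      "(LINT x|lborel. (\<Prod>b\<in>Basis. f b (x \<bullet> b))) = (\<Prod>b\<in>Basis. (LINT t|lborel. f b t))"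
proof -
  interpret product_sigma_finite "\<lambda>_::'a. lborel :: real measure" by standard
  have coord: "(\<Sum>b'\<in>Basis. g b' *\<^sub>R b') \<bullet> b = g b" if "b \<in> Basis" for g and b :: 'a
    using that by simp
  have [measurable]: "f b \<in> borel_measurable borel" if "b \<in> Basis" for b
    using borel_measurable_integrable[OF f[OF that]] by simp
  have [measurable]: "(\<lambda>x. \<Prod>b\<in>Basis. f b (x \<bullet> b)) \<in> borel_measurable borel"
    by (intro borel_measurable_prod) simp
  show "integrable lborel (\<lambda>x. \<Prod>b\<in>Basis. f b (x \<bullet> b))"
    unfolding lborel_eq[where 'a='a]
    by (subst integrable_distr_eq)
       (use product_integrable_prod[OF finite_Basis f] in \<open>auto simp: coord cong: prod.cong\<close>)
  show "(LINT x|lborel. (\<Prod>b\<in>Basis. f b (x \<bullet> b))) = (\<Prod>b\<in>Basis. (LINT t|lborel. f b t))"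
    unfolding lborel_eq[where 'a='a]
    by (subst integral_distr)
       (use product_integral_prod[OF finite_Basis f] in \<open>auto simp: coord cong: prod.cong\<close>)
qed

text \<open>The exponent is twice the dimension because each coordinate uses up one factor (1 +
  |x|)^2 \<ge> 1 + x_b^2, and the product of the functions 1/(1 + x_b^2) is integrable.\<close>

lemma integrable_inverse_weight:
  "integrable lborel (\<lambda>x::'a::euclidean_space. 1 / (1 + norm x) ^ (2 * DIM('a)))"
proof (rule Bochner_Integration.integrable_bound)
  have "integrable lborel (\<lambda>t::real. inverse (1 + t\<^sup>2))"
    using integrable_inverse_1_plus_square by (simp add: set_integrable_def)
  from integrable_lborel_prod[OF this]
  show "integrable lborel (\<lambda>x::'a. \<Prod>b\<in>Basis. inverse (1 + (x \<bullet> b)\<^sup>2))" .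
  show "AE x in lborel. norm (1 / (1 + norm x) ^ (2 * DIM('a))) \<le>
      norm (\<Prod>b\<in>Basis. inverse (1 + (x \<bullet> (b::'a))\<^sup>2))"
  proof (rule AE_I2)
    fix x :: 'a
    have "(\<Prod>b\<in>(Basis::'a set). inverse ((1 + norm x)\<^sup>2)) \<le> (\<Prod>b\<in>Basis. inverse (1 + (x \<bullet> b)\<^sup>2))"
    proof (intro prod_mono conjI le_imp_inverse_le)
      fix b :: 'a assume "b \<in> Basis"
      then have "\<bar>x \<bullet> b\<bar> \<le> norm x" by (rule Basis_le_norm)
      then have "(x \<bullet> b)\<^sup>2 \<le> (norm x)\<^sup>2" using power_mono[of "\<bar>x \<bullet> b\<bar>" "norm x" 2] by simp
      then show "1 + (x \<bullet> b)\<^sup>2 \<le> (1 + norm x)\<^sup>2"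
        by (simp add: power2_sum add_increasing2)
      show "0 < 1 + (x \<bullet> b)\<^sup>2" by (simp add: add_pos_nonneg)
    qed simp
    then show "norm (1 / (1 + norm x) ^ (2 * DIM('a))) \<le> norm (\<Prod>b\<in>Basis. inverse (1 + (x \<bullet> b)\<^sup>2))"
      by (simp add: power_mult power_inverse divide_inverse)
  qed
qed auto

section \<open>The Fourier transform on the Schwartz space\<close>

lemma schwartz_measurable [measurable_dest]:
  "f \<in> schwartz_space \<Longrightarrow> f \<in> borel_measurable borel"
  by (simp add: borel_measurable_continuous_onI schwartz_space_smooth smooth_fun_continuous)

lemma cis_measurable [measurable]: "cis \<in> borel_measurable borel"
  by (intro borel_measurable_continuous_onI continuous_intros)

text \<open>The weight is split: \<open>2 * CARD('n)\<close> powers make the majorant integrable and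
  \<open>k\<close> powers remain. The case \<open>k = 0\<close> gives integrability, the case
  \<open>k = 2\<close> pays for a second moment.\<close>

lemma schwartz_decay:
  fixes f :: "real^'n::finite \<Rightarrow> complex"
  assumes "f \<in> schwartz_space"
  shows "(1 + norm x) ^ k * cmod (f x) \<le>
    schwartz_seminorm (2 * CARD('n) + k) [] f * (1 / (1 + norm x) ^ (2 * CARD('n)))"
proof -
  have "(1 + norm x) ^ (2 * CARD('n)) * ((1 + norm x) ^ k * cmod (f x)) \<le>
      schwartz_seminorm (2 * CARD('n) + k) [] f"
    using schwartz_seminorm_upper[OF assms, of x "2 * CARD('n) + k" "[]"]
    by (simp add: power_add mult_ac)
  moreover have "0 < (1 + norm x) ^ (2 * CARD('n))" by (simp add: add_pos_nonneg)
  ultimately show ?thesis by (simp add: field_simps)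
qed

lemma integrable_weight_cart:
  "integrable lborel (\<lambda>x::real^'n::finite. c * (1 / (1 + norm x) ^ (2 * CARD('n))))"
  using integrable_inverse_weight[where 'a="real^'n"] by (intro integrable_mult_right) simp

lemma schwartz_integrable:
  fixes f :: "real^'n::finite \<Rightarrow> complex"
  assumes "f \<in> schwartz_space"
  shows "integrable lborel f"
proof (rule Bochner_Integration.integrable_bound[OF integrable_weight_cart])
  show "f \<in> borel_measurable lborel" using schwartz_measurable[OF assms] by simp
  show "AE x in lborel. norm (f x) \<le>
      norm (schwartz_seminorm (2 * CARD('n)) [] f * (1 / (1 + norm x) ^ (2 * CARD('n))))"
    using schwartz_decay[OF assms, of _ 0]
    by (intro AE_I2) (simp only: real_norm_def, rule order_trans[OF _ abs_ge_self], simp)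
qed

lemma integrable_cis_mult:
  assumes "integrable lborel f" and [measurable]: "g \<in> borel_measurable borel"
  shows "integrable lborel (\<lambda>x. cis (g x) * f x)"
proof (rule Bochner_Integration.integrable_bound[OF assms(1)])
  show "(\<lambda>x. cis (g x) * f x) \<in> borel_measurable lborel"
    using borel_measurable_integrable[OF assms(1)] by simp
qed (simp add: norm_mult)

lemma cmod_fourier_le:
  assumes "integrable lborel f"
  shows "cmod (fourier f \<xi>) \<le> (LINT x|lborel. cmod (f x))"
  using integral_norm_bound[of lborel "\<lambda>x. cis (- 2 * pi * (x \<bullet> \<xi>)) * f x"]
  by (simp add: fourier_def norm_mult)

lemma cmod_cis_approx: "cmod (cis t - 1 - \<i> * of_real t) \<le> t\<^sup>2"
  using iexp_approx1[of t 1] by (simp add: cis_conv_exp numeral_2_eq_2 algebra_simps) (smt (verit) zero_le_mult_iff)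

text \<open>Differentiation under the integral by a direct estimate: the first-order Taylor
  remainder of the phase is quadratic in \<open>h\<close>, with a coefficient dominated by the
  second moment of \<open>f\<close>. The full derivative is needed, since smoothness is defined by
  Frechet differentiability.\<close>

lemma fourier_has_derivative:
  fixes f :: "real^'n::finite \<Rightarrow> complex"
  assumes f: "f \<in> schwartz_space"
  shows "(fourier f has_derivative
    (\<lambda>h. \<Sum>j\<in>UNIV. of_real (h $ j) * fourier (\<lambda>x. - 2 * pi * \<i> * of_real (x $ j) * f x) \<xi>)) (at \<xi>)"
proof -
  define g where "g j = (\<lambda>x. - 2 * pi * \<i> * of_real (x $ j) * f x)" for j
  have g: "g j \<in> schwartz_space" for j
    using schwartz_continuous_in[OF schwartz_continuous_coord f] unfolding g_def .
  define S where "S = schwartz_seminorm (2 * CARD('n) + 2) [] f"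
  define w where "w = (\<lambda>x::real^'n. 1 / (1 + norm x) ^ (2 * CARD('n)))"
  \<comment> \<open>The factor \<open>4 * pi\<^sup>2\<close> is the square of the
    \<open>2 * pi\<close> in the phase; the factor |x|^2 from Cauchy-Schwarz is absorbed by the two
    extra powers of the weight in \<open>S\<close>.\<close>
  define M where "M = 4 * pi\<^sup>2 * S * integral\<^sup>L lborel w"
  define D where "D = (\<lambda>h::real^'n. \<Sum>j\<in>UNIV. of_real (h $ j) * fourier (g j) \<xi>)"
  have int: "integrable lborel (\<lambda>x. cis (- 2 * pi * (x \<bullet> \<eta>)) * u x)"
    if "u \<in> schwartz_space" for u \<eta>
    by (intro integrable_cis_mult schwartz_integrable that) simp
  have "(fourier f has_derivative D) (at \<xi>)"
  proof (rule has_derivativeI_sandwich[where e=1])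
    show "bounded_linear D"
      unfolding D_def
      by (intro bounded_linear_sum bounded_linear_compose[OF bounded_linear_mult_left]
          bounded_linear_compose[OF bounded_linear_of_real] bounded_linear_vec_nth)
    show "((\<lambda>\<eta>. M * norm (\<eta> - \<xi>)) \<longlongrightarrow> 0) (at \<xi>)"
      by (auto intro!: tendsto_eq_intros)
    fix \<eta> assume "\<eta> \<noteq> \<xi>"
    define h where "h = \<eta> - \<xi>"
    have D_eq: "D h = (LINT x|lborel. (\<Sum>j\<in>UNIV. of_real (h $ j) * (cis (- 2 * pi * (x \<bullet> \<xi>)) * g j x)))"
      unfolding D_def fourier_def using int[OF g] by (simp add: Bochner_Integration.integral_sum)
    have "fourier f \<eta> - fourier f \<xi> - D h = (LINT x|lborel. cis (- 2 * pi * (x \<bullet> \<eta>)) * f x -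
        cis (- 2 * pi * (x \<bullet> \<xi>)) * f x -
        (\<Sum>j\<in>UNIV. of_real (h $ j) * (cis (- 2 * pi * (x \<bullet> \<xi>)) * g j x)))"
      unfolding D_eq using int[OF g] int[OF f]
      by (simp add: fourier_def Bochner_Integration.integral_diff Bochner_Integration.integrable_sum)
    also have "cmod \<dots> \<le> (LINT x|lborel. (norm h)\<^sup>2 * (4 * pi\<^sup>2 * S * w x))"
    proof (rule Bochner_Integration.integral_norm_bound_integral)
      show "integrable lborel (\<lambda>x. (norm h)\<^sup>2 * (4 * pi\<^sup>2 * S * w x))"
        unfolding w_def by (intro integrable_mult_right integrable_weight_cart)
      fix x :: "real^'n"
      have "cis (- 2 * pi * (x \<bullet> \<eta>)) * f x - cis (- 2 * pi * (x \<bullet> \<xi>)) * f x -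
        (\<Sum>j\<in>UNIV. of_real (h $ j) * (cis (- 2 * pi * (x \<bullet> \<xi>)) * g j x)) =
        cis (- 2 * pi * (x \<bullet> \<xi>)) * (cis (- 2 * pi * (x \<bullet> h)) - 1 - \<i> * of_real (- 2 * pi * (x \<bullet> h))) * f x"
      proof -
        have 1: "cis (- 2 * pi * (x \<bullet> \<eta>)) = cis (- 2 * pi * (x \<bullet> \<xi>)) * cis (- 2 * pi * (x \<bullet> h))"
          by (simp add: cis_mult h_def inner_diff_right algebra_simps)
        have 2: "(\<Sum>j\<in>UNIV. of_real (h $ j) * (c * g j x)) = c * (\<i> * of_real (- 2 * pi * (x \<bullet> h))) * f x" for c
          unfolding g_def inner_vec_def
          by (simp add: sum_distrib_left sum_distrib_right sum_negf mult_ac)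
        show ?thesis unfolding 1 2 by (simp add: algebra_simps)
      qed
      also have "cmod \<dots> \<le> (- 2 * pi * (x \<bullet> h))\<^sup>2 * cmod (f x)"
        unfolding norm_mult norm_cis mult_1_left
        by (rule mult_right_mono[OF cmod_cis_approx norm_ge_zero])
      also have "\<dots> \<le> (norm h)\<^sup>2 * (4 * pi\<^sup>2 * ((1 + norm x) ^ 2 * cmod (f x)))"
      proof -
        have "(x \<bullet> h)\<^sup>2 \<le> (norm x * norm h)\<^sup>2"
          using power_mono[OF Cauchy_Schwarz_ineq2[of x h], of 2] by simp
        also have "\<dots> \<le> ((1 + norm x) * norm h)\<^sup>2"
          by (intro power_mono mult_right_mono) auto
        finally have "4 * pi\<^sup>2 * (x \<bullet> h)\<^sup>2 * cmod (f x) \<le> 4 * pi\<^sup>2 * ((1 + norm x) * norm h)\<^sup>2 * cmod (f x)"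
          by (intro mult_right_mono mult_left_mono) auto
        then show ?thesis by (simp add: power_mult_distrib mult_ac)
      qed
      also have "\<dots> \<le> (norm h)\<^sup>2 * (4 * pi\<^sup>2 * (S * w x))"
        unfolding S_def w_def by (intro mult_left_mono schwartz_decay f) auto
      finally show "cmod (cis (- 2 * pi * (x \<bullet> \<eta>)) * f x - cis (- 2 * pi * (x \<bullet> \<xi>)) * f x -
        (\<Sum>j\<in>UNIV. of_real (h $ j) * (cis (- 2 * pi * (x \<bullet> \<xi>)) * g j x))) \<le> (norm h)\<^sup>2 * (4 * pi\<^sup>2 * S * w x)"
        by (simp add: mult.assoc)
    next
      show "integrable lborel (\<lambda>x. cis (- 2 * pi * (x \<bullet> \<eta>)) * f x -
        cis (- 2 * pi * (x \<bullet> \<xi>)) * f x -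
        (\<Sum>j\<in>UNIV. of_real (h $ j) * (cis (- 2 * pi * (x \<bullet> \<xi>)) * g j x)))"
        by (intro Bochner_Integration.integrable_diff Bochner_Integration.integrable_sum
            integrable_mult_right int f g)
    qed
    also have "\<dots> = M * (norm h)\<^sup>2" by (simp add: M_def)
    finally show "norm ((fourier f \<eta> - fourier f \<xi>) - D (\<eta> - \<xi>)) / norm (\<eta> - \<xi>) \<le> M * norm (\<eta> - \<xi>)"
      using \<open>\<eta> \<noteq> \<xi>\<close> by (simp add: h_def divide_le_eq power2_eq_square mult.assoc)
  qed simp
  then show ?thesis by (simp add: D_def g_def)
qed

lemma partial_deriv_fourier:
  assumes "f \<in> schwartz_space"
  shows "partial_deriv i (fourier f) = fourier (\<lambda>x. - 2 * pi * \<i> * of_real (x $ i) * f x)"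
proof
  fix \<xi>
  show "partial_deriv i (fourier f) \<xi> = fourier (\<lambda>x. - 2 * pi * \<i> * of_real (x $ i) * f x) \<xi>"
    unfolding partial_deriv_eq[OF fourier_has_derivative[OF assms]]
    by (subst sum.remove[of _ i]) (auto simp: axis_def intro!: sum.neutral)
qed

text \<open>Dominated convergence is applied along sequences, so the derivative is expressed through
  the increments 1/(m+1), which also stay in (0, 1].\<close>

lemma has_vector_derivative_sequentially:
  fixes g :: "real \<Rightarrow> complex"
  assumes "(g has_vector_derivative v) (at 0)"
  shows "(\<lambda>m. of_nat (Suc m) * (g (1 / real (Suc m)) - g 0)) \<longlonglongrightarrow> v"
proof -
  have "((\<lambda>h. norm (g h - g 0 - h *\<^sub>R v) / norm h) \<longlongrightarrow> 0) (at 0)"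
    using assms by (simp add: has_vector_derivative_def has_derivative_at)
  moreover have "filterlim (\<lambda>m. 1 / real (Suc m)) (at 0) sequentially"
    using LIMSEQ_inverse_real_of_nat by (auto simp: filterlim_at inverse_eq_divide)
  ultimately have "(\<lambda>m. norm (g (1 / real (Suc m)) - g 0 - (1 / real (Suc m)) *\<^sub>R v) / norm (1 / real (Suc m)))
      \<longlonglongrightarrow> 0"
    by (rule filterlim_compose)
  moreover have "norm (g (1 / real (Suc m)) - g 0 - (1 / real (Suc m)) *\<^sub>R v) / norm (1 / real (Suc m)) =
      norm (of_nat (Suc m) * (g (1 / real (Suc m)) - g 0) - v)" for m
  proof -
    have "norm (of_nat (Suc m) * (g (1 / real (Suc m)) - g 0) - v) =
        norm (of_nat (Suc m) * (g (1 / real (Suc m)) - g 0 - (1 / real (Suc m)) *\<^sub>R v))"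
      by (simp add: scaleR_conv_of_real right_diff_distrib del: of_nat_Suc)
    also have "\<dots> = real (Suc m) * norm (g (1 / real (Suc m)) - g 0 - (1 / real (Suc m)) *\<^sub>R v)"
      by (simp only: norm_mult norm_of_nat)
    finally show ?thesis by (simp add: mult.commute del: of_nat_Suc)
  qed
  ultimately show ?thesis by (simp add: LIM_zero_iff tendsto_norm_zero_iff del: of_nat_Suc)
qed

lemma has_vector_derivative_along_axis:
  assumes "smooth_fun f"
  shows "((\<lambda>s. f (x + s *\<^sub>R axis i 1)) has_vector_derivative partial_deriv i f (x + t *\<^sub>R axis i 1)) (at t)"
proof -
  have 1: "((\<lambda>s. x + s *\<^sub>R axis i 1) has_derivative (\<lambda>s. s *\<^sub>R axis i 1)) (at t)"
    by (auto intro!: derivative_eq_intros)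
  have "(f has_derivative frechet_derivative f (at (x + t *\<^sub>R axis i 1))) (at (x + t *\<^sub>R axis i 1))"
    using smooth_fun_differentiable[OF assms] by (simp flip: frechet_derivative_works)
  from has_derivative_compose[OF 1 this] show ?thesis
    using linear_frechet_derivative[OF smooth_fun_differentiable[OF assms]]
    by (simp add: has_vector_derivative_def partial_deriv_def linear_cmul)
qed

lemma has_vector_derivative_cis:
  "((\<lambda>s. cis (a * s)) has_vector_derivative (\<i> * of_real a * cis (a * t))) (at t)"
proof -
  have "((\<lambda>s. a * s) has_vector_derivative a) (at t)"
    by (auto intro!: derivative_eq_intros)
  from vector_diff_chain_at[OF this has_vector_derivative_iexp]
  show ?thesis by (simp add: o_def cis_conv_exp scaleR_conv_of_real mult_ac)
qed

text \<open>Both sides are the derivative at \<open>t = 0\<close> of the transform of the translate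
  \<open>f (x + t *\<^sub>R axis i 1)\<close>; this avoids an integration by parts in one coordinate.\<close>

lemma fourier_partial_deriv:
  fixes f :: "real^'n::finite \<Rightarrow> complex"
  assumes f: "f \<in> schwartz_space"
  shows "fourier (partial_deriv i f) \<xi> = 2 * pi * \<i> * of_real (\<xi> $ i) * fourier f \<xi>"
proof -
  define e :: "real^'n" where "e = axis i 1"
  define t where "t m = 1 / real (Suc m)" for m
  have t: "0 < t m" "t m \<le> 1" "of_nat (Suc m) * complex_of_real (t m) = 1" for m
    by (simp_all add: t_def del: of_nat_Suc)
  define B where "B = schwartz_seminorm (2 * CARD('n)) [] (partial_deriv i f)"
  define w where "w = (\<lambda>x::real^'n. 1 / (1 + norm x) ^ (2 * CARD('n)))"
  have pf: "partial_deriv i f \<in> schwartz_space"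
    by (rule schwartz_continuous_in[OF schwartz_continuous_partial_deriv f])
  have [measurable]: "f \<in> borel_measurable borel" "partial_deriv i f \<in> borel_measurable borel"
    using schwartz_measurable f pf by auto
  have ne: "norm e = 1" by (simp add: e_def)
  \<comment> \<open>A shift by at most one unit vector changes the weight by a factor of at most 2
    per power, which gives one majorant for all \<open>s\<close> in the unit interval.\<close>
  have pb: "cmod (partial_deriv i f (x + s *\<^sub>R e)) \<le> 2 ^ (2 * CARD('n)) * B * w x"
    if "s \<in> {0..1}" for x s
  proof -
    have "norm x \<le> norm (x + s *\<^sub>R e) + norm (s *\<^sub>R e)"
      using norm_triangle_ineq4[of "x + s *\<^sub>R e" "s *\<^sub>R e"] by simp
    then have "norm x \<le> norm (x + s *\<^sub>R e) + 1" using that ne by simp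
    then have "1 + norm x \<le> 2 * (1 + norm (x + s *\<^sub>R e))" by (rule order_trans[OF add_left_mono]) simp
    then have "(1 + norm x) ^ (2 * CARD('n)) \<le> 2 ^ (2 * CARD('n)) * (1 + norm (x + s *\<^sub>R e)) ^ (2 * CARD('n))"
      by (simp flip: power_mult_distrib add: power_mono del: power_mult)
    then have "(1 + norm x) ^ (2 * CARD('n)) * cmod (partial_deriv i f (x + s *\<^sub>R e)) \<le>
        2 ^ (2 * CARD('n)) * ((1 + norm (x + s *\<^sub>R e)) ^ (2 * CARD('n)) * cmod (partial_deriv i f (x + s *\<^sub>R e)))"
      by (simp add: mult_right_mono flip: mult.assoc)
    also have "\<dots> \<le> 2 ^ (2 * CARD('n)) * B"
      unfolding B_def using schwartz_seminorm_upper[OF pf, of "x + s *\<^sub>R e" "2 * CARD('n)" "[]"]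
      by (intro mult_left_mono) auto
    finally have "(1 + norm x) ^ (2 * CARD('n)) * cmod (partial_deriv i f (x + s *\<^sub>R e)) \<le> 2 ^ (2 * CARD('n)) * B" .
    moreover have "0 < (1 + norm x) ^ (2 * CARD('n))" by (simp add: add_pos_nonneg)
    ultimately show ?thesis by (simp add: w_def field_simps)
  qed
  \<comment> \<open>By the mean value inequality along the segment, the bound on the derivative also
    dominates the difference quotients, uniformly in \<open>m\<close>.\<close>
  have quot: "cmod (of_nat (Suc m) * (f (x + t m *\<^sub>R e) - f x)) \<le> 2 ^ (2 * CARD('n)) * B * w x" for m x
  proof -
    have "cmod (f (x + t m *\<^sub>R e) - f (x + 0 *\<^sub>R e)) \<le> (2 ^ (2 * CARD('n)) * B * w x) * norm (t m - 0)"
    proof (rule differentiable_bound[where S="{0..1}"])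
      fix s :: real assume s: "s \<in> {0..1}"
      show "((\<lambda>s. f (x + s *\<^sub>R e)) has_derivative (\<lambda>h. h *\<^sub>R partial_deriv i f (x + s *\<^sub>R e))) (at s within {0..1})"
        using has_vector_derivative_along_axis[OF schwartz_space_smooth[OF f], of x i s]
        unfolding e_def has_vector_derivative_def by (rule has_derivative_at_withinI)
      show "onorm (\<lambda>h. h *\<^sub>R partial_deriv i f (x + s *\<^sub>R e)) \<le> 2 ^ (2 * CARD('n)) * B * w x"
        using pb[OF s, of x] onorm_scaleR_left[OF bounded_linear_ident, of "partial_deriv i f (x + s *\<^sub>R e)"]
        by (simp add: onorm_id)
    qed (use t[of m] in auto)
    from mult_left_mono[OF this, of "real (Suc m)"] show ?thesis
      using t(1)[of m] unfolding norm_mult norm_of_nat by (simp add: t_def mult_ac del: of_nat_Suc)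
  qed
  let ?c = "\<lambda>x. cis (- 2 * pi * (x \<bullet> \<xi>))"
  have lim1: "(\<lambda>m. LINT x|lborel. ?c x * (of_nat (Suc m) * (f (x + t m *\<^sub>R e) - f x))) \<longlonglongrightarrow> fourier (partial_deriv i f) \<xi>"
    unfolding fourier_def
  proof (rule integral_dominated_convergence[where w="\<lambda>x. 2 ^ (2 * CARD('n)) * B * w x"])
    show "integrable lborel (\<lambda>x. 2 ^ (2 * CARD('n)) * B * w x)"
      unfolding w_def by (rule integrable_weight_cart)
    show "AE x in lborel. (\<lambda>m. ?c x * (of_nat (Suc m) * (f (x + t m *\<^sub>R e) - f x)))
        \<longlonglongrightarrow> ?c x * partial_deriv i f x"
      using has_vector_derivative_sequentially[OF has_vector_derivative_along_axis[OF schwartz_space_smooth[OF f]], of _ i]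
      by (intro AE_I2 tendsto_mult_left) (simp add: t_def e_def del: of_nat_Suc)
    show "AE x in lborel. norm (?c x * (of_nat (Suc m) * (f (x + t m *\<^sub>R e) - f x))) \<le>
        2 ^ (2 * CARD('n)) * B * w x" for m
      using quot[of m] by (intro AE_I2) (simp only: norm_mult norm_cis mult_1 mult_1_left)
  qed (simp_all del: of_nat_Suc)
  \<comment> \<open>Translating \<open>f\<close> multiplies its transform by a phase, so the limit
    of the quotients is the derivative of that phase at 0.\<close>
  have shift: "(LINT x|lborel. ?c x * f (x + t m *\<^sub>R e)) = cis (2 * pi * \<xi> $ i * t m) * fourier f \<xi>"
    and shift_int: "integrable lborel (\<lambda>x. ?c x * f (x + t m *\<^sub>R e))" for m
  proof -
    have eq: "?c (x - t m *\<^sub>R e) = cis (2 * pi * \<xi> $ i * t m) * ?c x" for x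
      by (simp add: cis_mult inner_diff_left e_def inner_axis' algebra_simps)
    have "(LINT x|lborel. ?c (x - t m *\<^sub>R e) * f x) = (LINT x|lborel. ?c x * f (x + t m *\<^sub>R e))"
      using lborel_integral_affine[of "\<lambda>x. ?c (x - t m *\<^sub>R e) * f x" 1 "t m *\<^sub>R e"] by (simp add: add.commute)
    then show "(LINT x|lborel. ?c x * f (x + t m *\<^sub>R e)) = cis (2 * pi * \<xi> $ i * t m) * fourier f \<xi>"
      unfolding eq by (simp add: fourier_def mult.assoc)
    have "integrable (distr lborel borel ((+) (t m *\<^sub>R e))) f"
      unfolding lborel_distr_plus by (rule schwartz_integrable[OF f])
    then have "integrable lborel (\<lambda>x. f (t m *\<^sub>R e + x))" by (simp add: integrable_distr_eq)
    then show "integrable lborel (\<lambda>x. ?c x * f (x + t m *\<^sub>R e))"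
      by (intro integrable_cis_mult) (simp_all add: add.commute)
  qed
  have "(LINT x|lborel. ?c x * (of_nat (Suc m) * (f (x + t m *\<^sub>R e) - f x))) =
      of_nat (Suc m) * (cis (2 * pi * \<xi> $ i * t m) - cis (2 * pi * \<xi> $ i * 0)) * fourier f \<xi>" for m
  proof -
    have "(LINT x|lborel. ?c x * (of_nat (Suc m) * (f (x + t m *\<^sub>R e) - f x))) =
        (LINT x|lborel. of_nat (Suc m) * (?c x * f (x + t m *\<^sub>R e) - ?c x * f x))"
      by (simp add: algebra_simps)
    also have "\<dots> = of_nat (Suc m) * ((LINT x|lborel. ?c x * f (x + t m *\<^sub>R e)) - fourier f \<xi>)"
      using shift_int[of m] integrable_cis_mult[OF schwartz_integrable[OF f], of "\<lambda>x. - 2 * pi * (x \<bullet> \<xi>)"]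
      by (simp add: fourier_def del: of_nat_Suc)
    finally show ?thesis unfolding shift by (simp add: algebra_simps)
  qed
  moreover have "(\<lambda>m. of_nat (Suc m) * (cis (2 * pi * \<xi> $ i * t m) - cis (2 * pi * \<xi> $ i * 0)) * fourier f \<xi>)
      \<longlonglongrightarrow> \<i> * of_real (2 * pi * \<xi> $ i) * cis (2 * pi * \<xi> $ i * 0) * fourier f \<xi>"
    unfolding t_def
    by (intro tendsto_mult_right has_vector_derivative_sequentially has_vector_derivative_cis)
  ultimately have "(\<lambda>m. LINT x|lborel. ?c x * (of_nat (Suc m) * (f (x + t m *\<^sub>R e) - f x)))
      \<longlonglongrightarrow> \<i> * of_real (2 * pi * \<xi> $ i) * cis (2 * pi * \<xi> $ i * 0) * fourier f \<xi>"
    by (simp only:)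
  from LIMSEQ_unique[OF lim1 this] show ?thesis by (simp add: mult_ac)
qed

text \<open>Each power of the weight is traded for a derivative of \<open>f\<close>: multiplying the
  transform by a coordinate is, up to a constant, transforming a partial derivative. The unweighted
  case is the L^1 bound.\<close>

lemma seminorm_bounded_fourier:
  "seminorm_bounded (\<lambda>f \<xi>. (1 + norm \<xi>) ^ k * cmod (fourier f (\<xi> :: real^'n::finite)))"
proof (induction k)
  case 0
  define K where "K = (LINT x|lborel. 1 / (1 + norm (x::real^'n)) ^ (2 * CARD('n)))"
  show ?case
  proof (rule seminorm_boundedI)
    fix f :: "real^'n \<Rightarrow> complex" and \<xi> assume f: "f \<in> schwartz_space"
    have "cmod (fourier f \<xi>) \<le> (LINT x|lborel. cmod (f x))"
      by (rule cmod_fourier_le[OF schwartz_integrable[OF f]])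
    also have "\<dots> \<le> (LINT x|lborel. schwartz_seminorm (2 * CARD('n)) [] f * (1 / (1 + norm (x::real^'n)) ^ (2 * CARD('n))))"
      using schwartz_decay[OF f, of _ 0]
      by (intro Bochner_Integration.integral_mono integrable_weight_cart integrable_norm schwartz_integrable f) simp
    also have "\<dots> = K * schwartz_seminorm (2 * CARD('n)) [] f"
      unfolding K_def by (subst integral_mult_right_zero) (rule mult.commute)
    also have "\<dots> \<le> K * total_seminorm (2 * CARD('n)) f"
      using schwartz_seminorm_le_total[OF f, of "2 * CARD('n)" "[]"]
      by (intro mult_left_mono) (auto simp: K_def intro!: integral_nonneg_AE)
    finally show "(1 + norm \<xi>) ^ 0 * cmod (fourier f \<xi>) \<le> K * total_seminorm (2 * CARD('n)) f" by simp
  qed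
next
  case (Suc k)
  have "seminorm_bounded (\<lambda>f \<xi>. (1 + norm \<xi>) ^ k * cmod (fourier f \<xi>) +
      (\<Sum>j\<in>UNIV. (1 + norm \<xi>) ^ k * cmod (fourier (partial_deriv j f) (\<xi> :: real^'n))))"
    by (intro seminorm_bounded_add seminorm_bounded_sum Suc.IH finite
        seminorm_bounded_compose[OF Suc.IH] schwartz_continuous_partial_deriv)
  then show ?case
  proof (rule seminorm_bounded_mono)
    fix f :: "real^'n \<Rightarrow> complex" and \<xi> :: "real^'n" assume f: "f \<in> schwartz_space"
    have "1 + norm \<xi> \<le> 1 + (\<Sum>j\<in>UNIV. \<bar>\<xi> $ j\<bar>)" using norm_le_l1_cart[of \<xi>] by simp
    \<comment> \<open>The factor \<open>2 * pi\<close> is inserted so that each summand becomes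
      exactly the modulus of the factor in \<open>fourier_partial_deriv\<close>.\<close>
    also have "\<dots> \<le> 1 + (\<Sum>j\<in>UNIV. 2 * pi * \<bar>\<xi> $ j\<bar>)"
      using pi_ge_two by (intro add_left_mono sum_mono) (simp add: mult_le_cancel_right1)
    finally have "(1 + norm \<xi>) * ((1 + norm \<xi>) ^ k * cmod (fourier f \<xi>)) \<le>
       (1 + (\<Sum>j\<in>UNIV. 2 * pi * \<bar>\<xi> $ j\<bar>)) * ((1 + norm \<xi>) ^ k * cmod (fourier f \<xi>))"
      by (intro mult_right_mono) auto
    also have "\<dots> = (1 + norm \<xi>) ^ k * cmod (fourier f \<xi>) +
      (\<Sum>j\<in>UNIV. (1 + norm \<xi>) ^ k * cmod (fourier (partial_deriv j f) \<xi>))"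
      unfolding distrib_right sum_distrib_right fourier_partial_deriv[OF f]
      by (simp add: norm_mult mult_ac)
    finally show "\<exists>z. (1 + norm \<xi>) ^ Suc k * cmod (fourier f \<xi>) \<le>
      (1 + norm z) ^ k * cmod (fourier f z) +
      (\<Sum>j\<in>UNIV. (1 + norm z) ^ k * cmod (fourier (partial_deriv j f) z))"
      by (intro exI[of _ \<xi>]) (simp add: mult.assoc)
  qed
qed

text \<open>Derivatives of a transform are transforms of polynomial multiples. Keeping only the
  existence and continuity of \<open>T\<close> avoids writing down the polynomial.\<close>

lemma iter_partial_fourier:
  "\<exists>T. schwartz_continuous T \<and>
     (\<forall>f\<in>schwartz_space. iter_partial is (fourier f :: real^'n::finite \<Rightarrow> complex) = fourier (T f))"
proof (induction "is")
  case Nil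
  show ?case using schwartz_continuous_scale[of 1] by (intro exI[of _ "\<lambda>f. f"]) simp
next
  case (Cons i js)
  then obtain T where T: "schwartz_continuous T"
    "\<And>f. f \<in> schwartz_space \<Longrightarrow> iter_partial js (fourier f :: real^'n \<Rightarrow> complex) = fourier (T f)"
    by blast
  show ?case
  proof (intro exI conjI ballI)
    show "schwartz_continuous (\<lambda>f x. - 2 * pi * \<i> * of_real (x $ i) * T f x)"
      by (rule schwartz_continuous_compose[OF schwartz_continuous_coord T(1)])
    fix f :: "real^'n \<Rightarrow> complex" assume f: "f \<in> schwartz_space"
    show "iter_partial (i # js) (fourier f) = fourier (\<lambda>x. - 2 * pi * \<i> * of_real (x $ i) * T f x)"
      using partial_deriv_fourier[OF schwartz_continuous_in[OF T(1) f]] T(2)[OF f] by simp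
  qed
qed

lemma schwartz_continuous_fourier: "schwartz_continuous (fourier :: (real^'n::finite \<Rightarrow> complex) \<Rightarrow> _)"
  unfolding schwartz_continuous_def
proof (intro conjI ballI allI)
  fix f :: "real^'n \<Rightarrow> complex" assume f: "f \<in> schwartz_space"
  show "smooth_fun (fourier f)"
    unfolding smooth_fun_def
  proof (intro allI)
    fix "is" :: "'n list" and \<xi>
    obtain T where "schwartz_continuous T" "iter_partial is (fourier f) = fourier (T f)"
      using iter_partial_fourier[of "is"] f by blast
    then show "iter_partial is (fourier f) differentiable (at \<xi>)"
      using fourier_has_derivative[OF schwartz_continuous_in[OF _ f]] unfolding differentiable_def
      by (simp only:) blast
  qed
next
  fix k and "is" :: "'n list"
  obtain T where T: "schwartz_continuous T"
    "\<And>f. f \<in> schwartz_space \<Longrightarrow> iter_partial is (fourier f :: real^'n \<Rightarrow> complex) = fourier (T f)"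
    using iter_partial_fourier[of "is"] by blast
  from seminorm_bounded_compose[OF seminorm_bounded_fourier[of k] T(1)]
  show "seminorm_bounded (\<lambda>f \<xi>. (1 + norm \<xi>) ^ k * cmod (iter_partial is (fourier f) (\<xi> :: real^'n)))"
    by (rule seminorm_bounded_mono) (auto simp: T(2))
qed

section \<open>Fourier inversion\<close>

lemma integrable_lborel_affine:
  fixes f :: "'a::euclidean_space \<Rightarrow> 'b::{banach, second_countable_topology}"
  assumes f: "integrable lborel f" and "c \<noteq> 0"
  shows "integrable lborel (\<lambda>x. f (t + c *\<^sub>R x))"
proof -
  have [measurable]: "f \<in> borel_measurable borel" using borel_measurable_integrable[OF f] by simp
  have "integrable (density (distr lborel borel (\<lambda>x. t + c *\<^sub>R x)) (\<lambda>_. ennreal (\<bar>c\<bar> ^ DIM('a)))) f"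
    using f lborel_affine[OF assms(2), of t] by simp
  then have "integrable lborel (\<lambda>x. \<bar>c\<bar> ^ DIM('a) *\<^sub>R f (t + c *\<^sub>R x))"
    by (simp add: integrable_density integrable_distr_eq)
  from integrable_scaleR_right[OF this, of "inverse (\<bar>c\<bar> ^ DIM('a))"] show ?thesis
    using assms(2) by simp
qed

section \<open>Gaussians and their Fourier transforms\<close>

text \<open>Both claims are the known facts on the standard normal density and its characteristic
  function, rescaled by \<open>sqrt (2 * pi)\<close>: this dilation turns exp(-x^2/2) into
  exp(-\<pi> t^2), which is its own transform.\<close>

lemma
  shows integrable_gaussian_real: "integrable lborel (\<lambda>t::real. exp (- pi * t\<^sup>2))"
    and fourier_gaussian_real:
      "(LINT t|lborel. cis (- 2 * pi * (t * s)) * of_real (exp (- pi * t\<^sup>2))) = of_real (exp (- pi * s\<^sup>2))"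
proof -
  define r where "r = sqrt (2 * pi)"
  have r: "0 < r" "r * r = 2 * pi" by (simp_all add: r_def)
  have sq: "(r * t)\<^sup>2 = 2 * pi * t\<^sup>2" for t
    using r(2) by (simp add: power_mult_distrib power2_eq_square)
  have dens: "std_normal_density (r * t) = exp (- pi * t\<^sup>2) / r" for t
    unfolding std_normal_density_def sq by (simp add: r_def)
  have "integrable lborel (\<lambda>t. std_normal_density (0 + r *\<^sub>R t))"
    using r by (intro integrable_lborel_affine integrable_normal_density) auto
  then have "integrable lborel (\<lambda>t. exp (- pi * t\<^sup>2) / r)" by (simp add: dens)
  from integrable_mult_right[OF this, of r]
  show "integrable lborel (\<lambda>t::real. exp (- pi * t\<^sup>2))" using r(1) by simp
  have "of_real (exp (- pi * s\<^sup>2)) = char std_normal_distribution (- r * s)"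
    unfolding char_std_normal_distribution using sq[of s] by simp
  also have "\<dots> = (LINT t|lborel. std_normal_density t *\<^sub>R iexp (- r * s * t))"
    unfolding char_def by (subst integral_density) auto
  also have "\<dots> = r *\<^sub>R (LINT t|lborel. std_normal_density (r * t) *\<^sub>R iexp (- r * s * (r * t)))"
    using lborel_integral_affine[of "\<lambda>t. std_normal_density t *\<^sub>R iexp (- r * s * t)" r 0] r by simp
  also have "\<dots> = (LINT t|lborel. cis (- 2 * pi * (t * s)) * of_real (exp (- pi * t\<^sup>2)))"
  proof -
    have "r *\<^sub>R (std_normal_density (r * t) *\<^sub>R iexp (- r * s * (r * t))) =
        cis (- 2 * pi * (t * s)) * of_real (exp (- pi * t\<^sup>2))" for t
    proof -
      have "- r * s * (r * t) = - (r * r) * (t * s)" by (simp add: mult_ac)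
      then have eq: "- r * s * (r * t) = - 2 * pi * (t * s)" by (simp add: r(2))
      show ?thesis unfolding eq using r(1) by (simp add: dens cis_conv_exp scaleR_conv_of_real)
    qed
    then show ?thesis by (simp flip: integral_scaleR_right)
  qed
  finally show "(LINT t|lborel. cis (- 2 * pi * (t * s)) * of_real (exp (- pi * t\<^sup>2))) = of_real (exp (- pi * s\<^sup>2))"
    by simp
qed

definition gaussian :: "real^'n::finite \<Rightarrow> real" where
  "gaussian x = exp (- pi * (norm x)\<^sup>2)"

lemma gaussian_prod: "gaussian x = (\<Prod>b\<in>Basis. exp (- pi * (x \<bullet> b)\<^sup>2))"
  unfolding gaussian_def power2_norm_eq_inner
  by (subst euclidean_inner) (simp add: power2_eq_square sum_distrib_left flip: exp_sum sum_negf)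

lemma integrable_gaussian: "integrable lborel (gaussian :: real^'n::finite \<Rightarrow> real)"
  using integrable_lborel_prod[OF integrable_gaussian_real, where 'a="real^'n"]
  unfolding gaussian_prod[symmetric] .

lemma gaussian_measurable [measurable]: "gaussian \<in> borel_measurable borel"
  unfolding gaussian_def by measurable

lemma gaussian_bounds: "0 \<le> gaussian x" "gaussian x \<le> 1"
  by (simp_all add: gaussian_def)

lemma fourier_gaussian: "fourier (\<lambda>x. of_real (gaussian x)) \<xi> = of_real (gaussian \<xi>)"
proof -
  have int: "integrable lborel (\<lambda>t. cis (- 2 * pi * (t * s)) * of_real (exp (- pi * t\<^sup>2)))" for s
    by (intro integrable_cis_mult integrable_of_real integrable_gaussian_real) simp
  have "cis (- 2 * pi * (x \<bullet> \<xi>)) * of_real (gaussian x) =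
      (\<Prod>b\<in>Basis. cis (- 2 * pi * ((x \<bullet> b) * (\<xi> \<bullet> b))) * of_real (exp (- pi * (x \<bullet> b)\<^sup>2)))" for x
  proof -
    have "cis (- 2 * pi * (x \<bullet> \<xi>)) = (\<Prod>b\<in>Basis. cis (- 2 * pi * ((x \<bullet> b) * (\<xi> \<bullet> b))))"
      unfolding cis_conv_exp
      by (subst euclidean_inner) (simp add: sum_distrib_left flip: exp_sum sum_negf)
    then show ?thesis by (simp add: gaussian_prod prod.distrib)
  qed
  then have "fourier (\<lambda>x. of_real (gaussian x)) \<xi> = (LINT x|lborel.
      (\<Prod>b\<in>Basis. cis (- 2 * pi * ((x \<bullet> b) * (\<xi> \<bullet> b))) * of_real (exp (- pi * (x \<bullet> b)\<^sup>2))))"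
    by (simp add: fourier_def)
  also have "\<dots> = of_real (gaussian \<xi>)"
    unfolding integral_lborel_prod[OF int, of "\<lambda>b. \<xi> \<bullet> b"] fourier_gaussian_real
    by (simp add: gaussian_prod)
  finally show ?thesis .
qed

text \<open>Evaluating at \<open>\<epsilon> *\<^sub>R z\<close>, with the Jacobian on the left,
  matches what the substitution y = x + \<epsilon> z leaves in the Gaussian mean.\<close>

lemma fourier_gaussian_dilation:
  assumes "0 < \<epsilon>"
  shows "\<epsilon> ^ CARD('n) *\<^sub>R fourier (\<lambda>x. of_real (gaussian (\<epsilon> *\<^sub>R x))) (\<epsilon> *\<^sub>R z :: real^'n::finite) = of_real (gaussian z)"
proof -
  have "of_real (gaussian z) = fourier (\<lambda>x. of_real (gaussian x)) z" by (simp add: fourier_gaussian)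
  also have "\<dots> = \<epsilon> ^ CARD('n) *\<^sub>R fourier (\<lambda>x. of_real (gaussian (\<epsilon> *\<^sub>R x))) (\<epsilon> *\<^sub>R z)"
    using lborel_integral_affine[of "\<lambda>x. cis (- 2 * pi * (x \<bullet> z)) * of_real (gaussian x)" \<epsilon> 0] assms
    by (simp add: fourier_def)
  finally show ?thesis ..
qed

text \<open>Without damping, the integrand of the double integral has modulus independent of \<xi>
  and Fubini fails; the Gaussian factor makes it absolutely integrable. Exchanging the integrals
  moves the transform onto the Gaussian, and f is averaged around x at scale \<epsilon>.\<close>

lemma fourier_gaussian_mean:
  fixes f :: "real^'n::finite \<Rightarrow> complex"
  assumes f: "integrable lborel f" and e: "0 < \<epsilon>"
  shows "(LINT \<xi>|lborel. cis (2 * pi * (x \<bullet> \<xi>)) * fourier f \<xi> * of_real (gaussian (\<epsilon> *\<^sub>R \<xi>))) =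
    (LINT z|lborel. f (x + \<epsilon> *\<^sub>R z) * of_real (gaussian z))"
proof -
  have [measurable]: "f \<in> borel_measurable borel" using borel_measurable_integrable[OF f] by simp
  have cis_int: "integrable lborel (\<lambda>y. cis (2 * pi * ((x - y) \<bullet> \<xi>)) * f y)" for \<xi>
    by (intro integrable_cis_mult f) simp
  have "integrable lborel (\<lambda>\<xi>::real^'n. gaussian (0 + \<epsilon> *\<^sub>R \<xi>))"
    using e by (intro integrable_lborel_affine integrable_gaussian) auto
  then have g_int: "integrable lborel (\<lambda>\<xi>::real^'n. gaussian (\<epsilon> *\<^sub>R \<xi>))" by simp
  have int: "integrable (lborel \<Otimes>\<^sub>M lborel)
      (\<lambda>(\<xi>, y). cis (2 * pi * ((x - y) \<bullet> \<xi>)) * f y * of_real (gaussian (\<epsilon> *\<^sub>R \<xi>)))"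
  proof (rule lborel_pair.Fubini_integrable)
    show "integrable lborel (\<lambda>\<xi>. LINT y|lborel. norm (case (\<xi>, y) of (\<xi>, y) \<Rightarrow>
        cis (2 * pi * ((x - y) \<bullet> \<xi>)) * f y * of_real (gaussian (\<epsilon> *\<^sub>R \<xi>))))"
      using g_int by (simp add: norm_mult gaussian_bounds)
    show "AE \<xi> in lborel. integrable lborel (\<lambda>y. case (\<xi>, y) of (\<xi>, y) \<Rightarrow>
        cis (2 * pi * ((x - y) \<bullet> \<xi>)) * f y * of_real (gaussian (\<epsilon> *\<^sub>R \<xi>)))"
      using cis_int by simp
  qed simp
  have "cis (2 * pi * (x \<bullet> \<xi>)) * fourier f \<xi> * of_real (gaussian (\<epsilon> *\<^sub>R \<xi>)) =
      (LINT y|lborel. cis (2 * pi * ((x - y) \<bullet> \<xi>)) * f y * of_real (gaussian (\<epsilon> *\<^sub>R \<xi>)))" for \<xi>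
  proof -
    have "cis (2 * pi * ((x - y) \<bullet> \<xi>)) * f y =
        cis (2 * pi * (x \<bullet> \<xi>)) * (cis (- 2 * pi * (y \<bullet> \<xi>)) * f y)" for y
      unfolding mult.assoc[symmetric] cis_mult by (simp add: inner_diff_left algebra_simps)
    then show ?thesis by (simp only: fourier_def) simp
  qed
  then have "(LINT \<xi>|lborel. cis (2 * pi * (x \<bullet> \<xi>)) * fourier f \<xi> * of_real (gaussian (\<epsilon> *\<^sub>R \<xi>))) =
      (LINT \<xi>|lborel. (LINT y|lborel. cis (2 * pi * ((x - y) \<bullet> \<xi>)) * f y * of_real (gaussian (\<epsilon> *\<^sub>R \<xi>))))"
    by (simp only:)
  also have "\<dots> = (LINT y|lborel. (LINT \<xi>|lborel. cis (2 * pi * ((x - y) \<bullet> \<xi>)) * f y * of_real (gaussian (\<epsilon> *\<^sub>R \<xi>))))"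
    by (rule lborel_pair.Fubini_integral[OF int, symmetric])
  also have "\<dots> = (LINT y|lborel. f y * fourier (\<lambda>\<xi>. of_real (gaussian (\<epsilon> *\<^sub>R \<xi>))) (y - x))"
  proof -
    have "cis (2 * pi * ((x - y) \<bullet> \<xi>)) * f y * of_real (gaussian (\<epsilon> *\<^sub>R \<xi>)) =
        f y * (cis (- 2 * pi * (\<xi> \<bullet> (y - x))) * of_real (gaussian (\<epsilon> *\<^sub>R \<xi>)))" for y \<xi>
      by (simp add: inner_diff_left inner_diff_right inner_commute algebra_simps)
    then show ?thesis unfolding fourier_def by (simp only: integral_mult_right_zero)
  qed
  also have "\<dots> = \<epsilon> ^ CARD('n) *\<^sub>R (LINT z|lborel. f (x + \<epsilon> *\<^sub>R z) *
      fourier (\<lambda>\<xi>. of_real (gaussian (\<epsilon> *\<^sub>R \<xi>))) (\<epsilon> *\<^sub>R z))"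
  proof -
    have "(\<lambda>y. f y * fourier (\<lambda>\<xi>. of_real (gaussian (\<epsilon> *\<^sub>R \<xi>))) (y - x)) \<in> borel_measurable borel"
      unfolding fourier_def by measurable
    from lborel_integral_affine[OF this, of \<epsilon> x] show ?thesis using e by simp
  qed
  also have "\<dots> = (LINT z|lborel. f (x + \<epsilon> *\<^sub>R z) * of_real (gaussian z))"
  proof -
    have "\<epsilon> ^ CARD('n) *\<^sub>R (f (x + \<epsilon> *\<^sub>R z) * fourier (\<lambda>\<xi>. of_real (gaussian (\<epsilon> *\<^sub>R \<xi>))) (\<epsilon> *\<^sub>R z)) =
        f (x + \<epsilon> *\<^sub>R z) * of_real (gaussian z)" for z
      by (simp add: fourier_gaussian_dilation[OF e] flip: mult_scaleR_right)
    then show ?thesis by (simp flip: integral_scaleR_right)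
  qed
  finally show ?thesis .
qed

text \<open>Let the damping tend to 0 in \<open>fourier_gaussian_mean\<close>: one side tends to the
  inversion integral, the other to f(x). Applying \<open>fourier\<close> twice and reflecting avoids
  a separate inverse transform.\<close>

theorem fourier_inversion:
  fixes f :: "real^'n::finite \<Rightarrow> complex"
  assumes f: "f \<in> schwartz_space"
  shows "fourier (fourier f) (- x) = f x"
proof -
  define t where "t m = 1 / real (Suc m)" for m
  have t: "0 < t m" for m by (simp add: t_def)
  have t_lim: "t \<longlonglongrightarrow> 0"
    unfolding t_def using LIMSEQ_inverse_real_of_nat by (simp add: inverse_eq_divide)
  have F: "fourier f \<in> schwartz_space" by (rule schwartz_continuous_in[OF schwartz_continuous_fourier f])
  have [measurable]: "f \<in> borel_measurable borel" "fourier f \<in> borel_measurable borel"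
    using schwartz_measurable f F by auto
  have g_cont: "isCont gaussian y" for y :: "real^'n"
    unfolding gaussian_def by (intro continuous_intros)
  \<comment> \<open>The transform is itself a Schwartz function, hence an integrable majorant for
    the damped integrands.\<close>
  have lim1: "(\<lambda>m. LINT \<xi>|lborel. cis (2 * pi * (x \<bullet> \<xi>)) * fourier f \<xi> * of_real (gaussian (t m *\<^sub>R \<xi>)))
      \<longlonglongrightarrow> (LINT \<xi>|lborel. cis (2 * pi * (x \<bullet> \<xi>)) * fourier f \<xi>)"
  proof (rule integral_dominated_convergence[where w="\<lambda>\<xi>. cmod (fourier f \<xi>)"])
    show "integrable lborel (\<lambda>\<xi>. cmod (fourier f \<xi>))" by (intro integrable_norm schwartz_integrable F)
    show "AE \<xi> in lborel. (\<lambda>m. cis (2 * pi * (x \<bullet> \<xi>)) * fourier f \<xi> * of_real (gaussian (t m *\<^sub>R \<xi>)))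
        \<longlonglongrightarrow> cis (2 * pi * (x \<bullet> \<xi>)) * fourier f \<xi>"
    proof (rule AE_I2)
      fix \<xi> :: "real^'n"
      have "(\<lambda>m. gaussian (t m *\<^sub>R \<xi>)) \<longlonglongrightarrow> gaussian (0 *\<^sub>R \<xi>)"
        by (intro isCont_tendsto_compose[OF g_cont] tendsto_intros t_lim)
      then have "(\<lambda>m. complex_of_real (gaussian (t m *\<^sub>R \<xi>))) \<longlonglongrightarrow> of_real 1"
        by (intro tendsto_of_real) (simp add: gaussian_def)
      from tendsto_mult_left[OF this, of "cis (2 * pi * (x \<bullet> \<xi>)) * fourier f \<xi>"]
      show "(\<lambda>m. cis (2 * pi * (x \<bullet> \<xi>)) * fourier f \<xi> * of_real (gaussian (t m *\<^sub>R \<xi>)))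
        \<longlonglongrightarrow> cis (2 * pi * (x \<bullet> \<xi>)) * fourier f \<xi>" by simp
    qed
    show "AE \<xi> in lborel. norm (cis (2 * pi * (x \<bullet> \<xi>)) * fourier f \<xi> * of_real (gaussian (t m *\<^sub>R \<xi>)))
        \<le> cmod (fourier f \<xi>)" for m
      by (intro AE_I2) (simp add: norm_mult gaussian_bounds mult_left_le)
  qed simp_all
  have eq1: "(LINT \<xi>|lborel. cis (2 * pi * (x \<bullet> \<xi>)) * fourier f \<xi>) = fourier (fourier f) (- x)"
    by (simp add: fourier_def[of "fourier f"] inner_commute)
  \<comment> \<open>Here continuity and boundedness of \<open>f\<close> suffice, the Gaussian being
    integrable.\<close>
  have lim2: "(\<lambda>m. LINT z|lborel. f (x + t m *\<^sub>R z) * of_real (gaussian z)) \<longlonglongrightarrow>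
      (LINT z|lborel. f x * of_real (gaussian (z::real^'n)))"
  proof (rule integral_dominated_convergence[where w="\<lambda>z. schwartz_seminorm 0 [] f * gaussian z"])
    show "integrable lborel (\<lambda>z::real^'n. schwartz_seminorm 0 [] f * gaussian z)"
      by (intro integrable_mult_right integrable_gaussian)
    show "AE z in lborel. (\<lambda>m. f (x + t m *\<^sub>R z) * of_real (gaussian z)) \<longlonglongrightarrow> f x * of_real (gaussian z)"
    proof (rule AE_I2)
      fix z :: "real^'n"
      have "isCont f (x + 0 *\<^sub>R z)"
        using smooth_fun_continuous[OF schwartz_space_smooth[OF f]]
        by (simp add: continuous_on_eq_continuous_at)
      then have "(\<lambda>m. f (x + t m *\<^sub>R z)) \<longlonglongrightarrow> f (x + 0 *\<^sub>R z)"
        by (rule isCont_tendsto_compose) (intro tendsto_intros t_lim)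
      then show "(\<lambda>m. f (x + t m *\<^sub>R z) * of_real (gaussian z)) \<longlonglongrightarrow> f x * of_real (gaussian z)"
        by (intro tendsto_mult_right) simp
    qed
    show "AE z in lborel. norm (f (x + t m *\<^sub>R z) * of_real (gaussian z)) \<le> schwartz_seminorm 0 [] f * gaussian z" for m
      using schwartz_seminorm_upper[OF f, of _ 0 "[]"]
      by (intro AE_I2) (simp add: norm_mult gaussian_bounds mult_right_mono)
  qed simp_all
  \<comment> \<open>The total mass of the Gaussian is its transform at the origin, which is
    1.\<close>
  have eq2: "(LINT z|lborel. f x * of_real (gaussian (z::real^'n))) = f x"
    using fourier_gaussian[of "0::real^'n"] by (simp add: fourier_def gaussian_def[of 0])
  show ?thesis
    using LIMSEQ_unique[OF lim1[unfolded fourier_gaussian_mean[OF schwartz_integrable[OF f] t]] lim2]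
    unfolding eq1 eq2 .
qed

section \<open>The fractional Fourier transform\<close>

lemma schwartz_space_add:
  assumes "f \<in> schwartz_space" "g \<in> schwartz_space"
  shows "(\<lambda>x. f x + g x) \<in> schwartz_space"
  unfolding schwartz_space_def mem_Collect_eq
proof (intro conjI allI)
  show "smooth_fun (\<lambda>x. f x + g x)" using assms by (simp add: schwartz_space_smooth smooth_fun_add)
  fix k and "is" :: "'a list"
  have "iter_partial is (\<lambda>x. f x + g x) = (\<lambda>x. iter_partial is f x + iter_partial is g x)"
    using assms by (intro iter_partial_add) (auto simp: schwartz_space_def smooth_fun_def)
  moreover have "(1 + norm x) ^ k * cmod (iter_partial is f x + iter_partial is g x) \<le>
      schwartz_seminorm k is f + schwartz_seminorm k is g" for x
  proof -
    have "(1 + norm x) ^ k * cmod (iter_partial is f x + iter_partial is g x) \<le>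
        (1 + norm x) ^ k * (cmod (iter_partial is f x) + cmod (iter_partial is g x))"
      by (intro mult_left_mono norm_triangle_ineq) auto
    then show ?thesis
      using schwartz_seminorm_upper[OF assms(1), of x k "is"] schwartz_seminorm_upper[OF assms(2), of x k "is"]
      by (simp add: distrib_left)
  qed
  ultimately show "bdd_above (range (\<lambda>x. (1 + norm x) ^ k * cmod (iter_partial is (\<lambda>x. f x + g x) x)))"
    by (intro bdd_aboveI[where M="schwartz_seminorm k is f + schwartz_seminorm k is g"]) auto
qed

lemma schwartz_continuous_frft:
  assumes "sin \<alpha> \<noteq> 0"
  shows "schwartz_continuous (frft c \<alpha> :: (real^'n::finite \<Rightarrow> complex) \<Rightarrow> _)"
proof -
  have "schwartz_continuous (\<lambda>f x. c * of_real (\<bar>sin \<alpha>\<bar> powr (- real CARD('n) / 2)) *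
      chirp \<alpha> (\<lambda>\<xi>::real^'n. fourier (chirp \<alpha> f) (inverse (sin \<alpha>) *\<^sub>R \<xi>)) x)"
    using assms
    by (intro schwartz_continuous_compose[OF schwartz_continuous_scale]
        schwartz_continuous_compose[OF schwartz_continuous_chirp]
        schwartz_continuous_compose[OF schwartz_continuous_dilation]
        schwartz_continuous_compose[OF schwartz_continuous_fourier] schwartz_continuous_chirp) auto
  also have "(\<lambda>f x. c * of_real (\<bar>sin \<alpha>\<bar> powr (- real CARD('n) / 2)) *
      chirp \<alpha> (\<lambda>\<xi>::real^'n. fourier (chirp \<alpha> f) (inverse (sin \<alpha>) *\<^sub>R \<xi>)) x) = frft c \<alpha>"
    by (intro ext) (simp add: frft_def chirp_def mult.assoc)
  finally show ?thesis .
qed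

lemma fourier_mult_left: "fourier (\<lambda>x. a * f x) \<xi> = a * fourier f \<xi>"
  by (simp add: fourier_def mult.left_commute)

text \<open>The chirps cancel because the cotangent is odd. Two factors |sin \<alpha>|^(-n/2) cancel
  the Jacobian |sin \<alpha>|^n of the dilation, and \<open>cnj c\<close> cancels \<open>c\<close>
  since it has modulus one.\<close>

lemma frft_inverse:
  fixes f :: "real^'n::finite \<Rightarrow> complex"
  assumes s: "sin \<alpha> \<noteq> 0" and c: "cmod c = 1" and f: "f \<in> schwartz_space"
  shows "frft (cnj c) (- \<alpha>) (frft c \<alpha> f) = f"
proof
  fix x
  define r where "r = \<bar>sin \<alpha>\<bar> powr (- real CARD('n) / 2)"
  have r: "r * r * \<bar>sin \<alpha>\<bar> ^ CARD('n) = 1"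
    using s by (simp add: r_def powr_add[symmetric] powr_realpow[symmetric])
  have cancel: "inverse (sin \<alpha>) * (sin \<alpha> * a) = a" for a
    using s by simp
  define h where "h = chirp \<alpha> f"
  have h: "h \<in> schwartz_space"
    unfolding h_def by (rule schwartz_continuous_in[OF schwartz_continuous_chirp f])
  have [measurable]: "fourier h \<in> borel_measurable borel"
    by (rule schwartz_measurable[OF schwartz_continuous_in[OF schwartz_continuous_fourier h]])
  have "chirp (- \<alpha>) (frft c \<alpha> f) = (\<lambda>\<xi>. c * of_real r * fourier h (\<xi> /\<^sub>R sin \<alpha>))"
  proof
    fix \<xi>
    have "cis (- a) * cis a = 1" for a by (simp add: cis_mult)
    then show "chirp (- \<alpha>) (frft c \<alpha> f) \<xi> = c * of_real r * fourier h (\<xi> /\<^sub>R sin \<alpha>)"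
      by (simp add: chirp_def[of "- \<alpha>"] frft_def r_def h_def cot_minus)
  qed
  moreover have "fourier (\<lambda>\<xi>. c * of_real r * fourier h (\<xi> /\<^sub>R sin \<alpha>)) (x /\<^sub>R sin (- \<alpha>)) =
      c * of_real r * (\<bar>sin \<alpha>\<bar> ^ CARD('n) * h x)"
  proof -
    \<comment> \<open>Rescaling the variable by sin \<alpha> removes the dilation; since the sine is
      odd, the frequency becomes \<open>- x\<close>, as the inversion formula requires.\<close>
    have "(LINT \<xi>|lborel. cis (- 2 * pi * (\<xi> \<bullet> (x /\<^sub>R sin (- \<alpha>)))) * fourier h (\<xi> /\<^sub>R sin \<alpha>)) =
      \<bar>sin \<alpha>\<bar> ^ CARD('n) *\<^sub>R (LINT \<xi>|lborel. cis (- 2 * pi * (\<xi> \<bullet> (- x))) * fourier h \<xi>)"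
      using lborel_integral_affine[of "\<lambda>\<xi>. cis (- 2 * pi * (\<xi> \<bullet> (x /\<^sub>R sin (- \<alpha>)))) * fourier h (\<xi> /\<^sub>R sin \<alpha>)" "sin \<alpha>" 0] s
        cancel by simp
    also have "(LINT \<xi>|lborel. cis (- 2 * pi * (\<xi> \<bullet> (- x))) * fourier h \<xi>) = h x"
      using fourier_inversion[OF h, of x] by (simp add: fourier_def[of "fourier h"])
    finally show ?thesis
      unfolding fourier_mult_left
      by (simp only: fourier_def[of "\<lambda>\<xi>. fourier h (\<xi> /\<^sub>R sin \<alpha>)"] scaleR_conv_of_real[where 'a=complex])
  qed
  ultimately have "fourier (chirp (- \<alpha>) (frft c \<alpha> f)) (x /\<^sub>R sin (- \<alpha>)) =
      c * of_real r * (\<bar>sin \<alpha>\<bar> ^ CARD('n) * h x)"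
    by (simp only:)
  then have "frft (cnj c) (- \<alpha>) (frft c \<alpha> f) x =
      cnj c * of_real r * cis (- (pi * (norm x)\<^sup>2 * cot \<alpha>)) *
      (c * of_real r * (\<bar>sin \<alpha>\<bar> ^ CARD('n) * h x))"
    unfolding frft_def[of "cnj c"] by (simp add: r_def cot_minus)
  also have "\<dots> = (cnj c * c) * of_real (r * r * \<bar>sin \<alpha>\<bar> ^ CARD('n)) * (cis (- (pi * (norm x)\<^sup>2 * cot \<alpha>)) * h x)"
    by simp
  also have "cis (- (pi * (norm x)\<^sup>2 * cot \<alpha>)) * h x = f x"
    unfolding h_def chirp_def mult.assoc[symmetric] cis_mult by simp
  also have "cnj c * c = 1" using c by (simp add: complex_norm_square[symmetric] mult.commute[of "cnj c"])
  finally show "frft (cnj c) (- \<alpha>) (frft c \<alpha> f) x = f x" unfolding r by simp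
qed

section \<open>Duality: the transform of tempered distributions\<close>

text \<open>With a dummy parameter of type \<open>unit\<close>, continuity of a distribution becomes
  an instance of \<open>seminorm_bounded\<close>, so that \<open>seminorm_bounded_compose\<close>
  transports it.\<close>

lemma tempered_distributions_iff:
  "u \<in> tempered_distributions \<longleftrightarrow> u \<in> extensional schwartz_space \<and>
     (\<forall>\<phi>\<in>schwartz_space. \<forall>\<psi>\<in>schwartz_space. u (\<lambda>x. \<phi> x + \<psi> x) = u \<phi> + u \<psi>) \<and>
     (\<forall>a. \<forall>\<phi>\<in>schwartz_space. u (\<lambda>x. a * \<phi> x) = a * u \<phi>) \<and>
     seminorm_bounded (\<lambda>\<phi> (y::unit). cmod (u \<phi>))"
  unfolding tempered_distributions_def seminorm_bounded_def total_seminorm_def by auto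

text \<open>Splitting the integral needs integrability of both parts, which the chirped Schwartz
  functions provide.\<close>

lemma frft_add:
  fixes f g :: "real^'n::finite \<Rightarrow> complex"
  assumes "f \<in> schwartz_space" "g \<in> schwartz_space"
  shows "frft c \<alpha> (\<lambda>x. f x + g x) = (\<lambda>\<xi>. frft c \<alpha> f \<xi> + frft c \<alpha> g \<xi>)"
proof -
  have int: "integrable lborel (\<lambda>x. cis (- 2 * pi * (x \<bullet> \<xi>)) * chirp \<alpha> u x)"
    if "u \<in> schwartz_space" for u :: "real^'n \<Rightarrow> complex" and \<xi>
    by (intro integrable_cis_mult schwartz_integrable schwartz_continuous_in[OF schwartz_continuous_chirp] that) simp
  have "chirp \<alpha> (\<lambda>x. f x + g x) x = chirp \<alpha> f x + chirp \<alpha> g x" for x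
    by (simp add: chirp_def distrib_left)
  then have "fourier (chirp \<alpha> (\<lambda>x. f x + g x)) \<xi> = fourier (chirp \<alpha> f) \<xi> + fourier (chirp \<alpha> g) \<xi>" for \<xi>
    using int[OF assms(1), of \<xi>] int[OF assms(2), of \<xi>] by (simp add: fourier_def distrib_left)
  then show ?thesis by (simp add: frft_def[abs_def] distrib_left)
qed

lemma frft_scale: "frft c \<alpha> (\<lambda>x. a * f x) = (\<lambda>\<xi>. a * frft c \<alpha> f \<xi>)"
proof -
  have "chirp \<alpha> (\<lambda>x. a * f x) = (\<lambda>x. a * chirp \<alpha> f x)" by (auto simp: chirp_def)
  then show ?thesis by (simp add: frft_def[abs_def] fourier_mult_left mult_ac)
qed

lemma frft_dist_tempered:
  fixes u :: "'n::finite functional"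
  assumes s: "sin \<alpha> \<noteq> 0" and u: "u \<in> tempered_distributions"
  shows "frft_dist c \<alpha> u \<in> tempered_distributions"
  unfolding tempered_distributions_iff
proof (intro conjI ballI allI)
  have T: "schwartz_continuous (frft c \<alpha> :: (real^'n \<Rightarrow> complex) \<Rightarrow> _)"
    by (rule schwartz_continuous_frft[OF s])
  note in_S = schwartz_continuous_in[OF T]
  show "frft_dist c \<alpha> u \<in> extensional schwartz_space" by (simp add: frft_dist_def)
  show "frft_dist c \<alpha> u (\<lambda>x. \<phi> x + \<psi> x) = frft_dist c \<alpha> u \<phi> + frft_dist c \<alpha> u \<psi>"
    if "\<phi> \<in> schwartz_space" "\<psi> \<in> schwartz_space" for \<phi> \<psi>
    using that u in_S by (simp add: frft_dist_def schwartz_space_add frft_add tempered_distributions_iff)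
  show "frft_dist c \<alpha> u (\<lambda>x. a * \<phi> x) = a * frft_dist c \<alpha> u \<phi>" if "\<phi> \<in> schwartz_space" for a \<phi>
    using that u in_S schwartz_continuous_in[OF schwartz_continuous_scale that]
    by (simp add: frft_dist_def frft_scale tempered_distributions_iff)
  have "seminorm_bounded (\<lambda>\<phi> (y::unit). cmod (u (frft c \<alpha> \<phi>)))"
    using seminorm_bounded_compose[OF _ T, of "\<lambda>\<phi> (y::unit). cmod (u \<phi>)"] u
    by (simp add: tempered_distributions_iff)
  then show "seminorm_bounded (\<lambda>\<phi> (y::unit). cmod (frft_dist c \<alpha> u \<phi>))"
    by (rule seminorm_bounded_mono) (simp add: frft_dist_def)
qed

text \<open>Transforms act on the test function in the opposite order, so this is
  \<open>frft_inverse\<close> inside the argument of \<open>u\<close>. Outside the Schwartz space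
  both sides are \<open>undefined\<close> by extensionality.\<close>

lemma frft_dist_inverse:
  fixes u :: "'n::finite functional"
  assumes "sin \<alpha> \<noteq> 0" "cmod c = 1" "u \<in> tempered_distributions"
  shows "frft_dist c \<alpha> (frft_dist (cnj c) (- \<alpha>) u) = u"
proof
  fix \<phi> :: "real^'n \<Rightarrow> complex"
  have "frft c \<alpha> \<phi> \<in> schwartz_space" if "\<phi> \<in> schwartz_space"
    using schwartz_continuous_in[OF schwartz_continuous_frft that] assms(1) .
  moreover have "u \<phi> = undefined" if "\<phi> \<notin> schwartz_space"
    using assms(3) that by (auto simp: tempered_distributions_iff extensional_def)
  ultimately show "frft_dist c \<alpha> (frft_dist (cnj c) (- \<alpha>) u) \<phi> = u \<phi>"
    using frft_inverse[OF assms(1,2), of \<phi>] by (cases "\<phi> \<in> schwartz_space") (auto simp: frft_dist_def)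
qed

lemma bij_betw_frft_dist:
  assumes "sin \<alpha> \<noteq> 0" "cmod c = 1"
  shows "bij_betw (frft_dist c \<alpha>) (tempered_distributions :: 'n::finite functional set) tempered_distributions"
proof (rule bij_betw_byWitness[where f'="frft_dist (cnj c) (- \<alpha>)"])
  show "\<forall>u\<in>(tempered_distributions :: 'n functional set). frft_dist (cnj c) (- \<alpha>) (frft_dist c \<alpha> u) = u"
    \<comment> \<open>Negation and conjugation are involutions, so the same lemma covers the other
      composition.\<close>
    using frft_dist_inverse[where 'n='n, of "- \<alpha>" "cnj c"] assms by simp
  show "\<forall>u\<in>(tempered_distributions :: 'n functional set). frft_dist c \<alpha> (frft_dist (cnj c) (- \<alpha>) u) = u"
    using frft_dist_inverse assms by blast
qed (use frft_dist_tempered[of \<alpha>] frft_dist_tempered[of "- \<alpha>"] assms in auto)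

section \<open>Conjugation by a bijection\<close>

text \<open>A constant bounds the conjugated operator exactly when it bounds \<open>S\<close>, so
  the two operator norms are infima of the same set.\<close>

lemma
  assumes F: "bij_betw F A A" and X: "X \<subseteq> A" and Y: "Y \<subseteq> A"
    and S: "bounded_operator X nX Y nY S"
  shows bounded_operator_conjugate:
      "bounded_operator {f \<in> A. F f \<in> X} (\<lambda>f. nX (F f)) {f \<in> A. F f \<in> Y} (\<lambda>f. nY (F f))
         (the_inv_into A F \<circ> S \<circ> F)"
    and operator_norm_conjugate:
      "operator_norm {f \<in> A. F f \<in> X} (\<lambda>f. nX (F f)) (\<lambda>f. nY (F f)) (the_inv_into A F \<circ> S \<circ> F) =
       operator_norm X nX nY S"
proof -
  have SY: "S g \<in> Y" if "g \<in> X" for g using S that by (simp add: bounded_operator_def)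
  have inv: "F (the_inv_into A F g) = g" "the_inv_into A F g \<in> A" if "g \<in> A" for g
    using F that by (auto simp: bij_betw_def f_the_inv_into_f the_inv_into_into)
  have conj: "F (the_inv_into A F (S (F f))) = S (F f)" "the_inv_into A F (S (F f)) \<in> A"
    if "F f \<in> X" for f
    using inv SY[OF that] Y by auto
  note X = subsetD[OF X]
  \<comment> \<open>Surjectivity of \<open>F\<close> makes every \<open>g\<close> in
    \<open>X\<close> the image of its preimage; conversely \<open>F\<close> undoes the outer inverse
    because \<open>S\<close> maps \<open>X\<close> into \<open>Y\<close> and hence into
    \<open>A\<close>.\<close>
  have all: "(\<forall>f\<in>{f \<in> A. F f \<in> X}. nY (F ((the_inv_into A F \<circ> S \<circ> F) f)) \<le> C * nX (F f)) \<longleftrightarrow>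
      (\<forall>g\<in>X. nY (S g) \<le> C * nX g)" for C
  proof -
    have "(\<forall>f\<in>{f \<in> A. F f \<in> X}. nY (S (F f)) \<le> C * nX (F f)) \<longleftrightarrow> (\<forall>g\<in>X. nY (S g) \<le> C * nX g)"
    proof (intro iffI ballI)
      fix g assume *: "\<forall>f\<in>{f \<in> A. F f \<in> X}. nY (S (F f)) \<le> C * nX (F f)" and "g \<in> X"
      then show "nY (S g) \<le> C * nX g"
        using bspec[OF *, of "the_inv_into A F g"] inv[OF X[OF \<open>g \<in> X\<close>]] by simp
    qed simp
    then show ?thesis by (simp add: conj)
  qed
  show "bounded_operator {f \<in> A. F f \<in> X} (\<lambda>f. nX (F f)) {f \<in> A. F f \<in> Y} (\<lambda>f. nY (F f))
         (the_inv_into A F \<circ> S \<circ> F)"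
    using S unfolding bounded_operator_def all by (auto simp: conj)
  show "operator_norm {f \<in> A. F f \<in> X} (\<lambda>f. nX (F f)) (\<lambda>f. nY (F f)) (the_inv_into A F \<circ> S \<circ> F) =
       operator_norm X nX nY S"
    unfolding operator_norm_def all ..
qed

theorem theorem9p2:
  fixes \<alpha> :: real and c :: complex and p q :: ennreal
    and S :: "'n::finite functional \<Rightarrow> 'n functional"
  assumes "\<forall>k::int. \<alpha> \<noteq> of_int k * pi"
    and "cmod c = 1"
    and "1 \<le> p" and "1 \<le> q"
  shows "(bounded_operator (Lp p) (Lp_norm p) (Lp q) (Lp_norm q) S \<longrightarrow>
            bounded_operator (Lp_pullback c \<alpha> p) (Lp_pullback_norm c \<alpha> p)
              (Lp_pullback c \<alpha> q) (Lp_pullback_norm c \<alpha> q) (frac_operator c \<alpha> S) \<and>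
            operator_norm (Lp_pullback c \<alpha> p) (Lp_pullback_norm c \<alpha> p)
              (Lp_pullback_norm c \<alpha> q) (frac_operator c \<alpha> S)
            = operator_norm (Lp p) (Lp_norm p) (Lp_norm q) S) \<and>
         (q < \<infinity> \<longrightarrow>
          bounded_operator (Lp p) (Lp_norm p)
            (weak_Lp (enn2real q)) (weak_Lp_norm (enn2real q)) S \<longrightarrow>
            bounded_operator (Lp_pullback c \<alpha> p) (Lp_pullback_norm c \<alpha> p)
              (weak_Lp_pullback c \<alpha> (enn2real q)) (weak_Lp_pullback_norm c \<alpha> (enn2real q))
              (frac_operator c \<alpha> S) \<and>
            operator_norm (Lp_pullback c \<alpha> p) (Lp_pullback_norm c \<alpha> p)
              (weak_Lp_pullback_norm c \<alpha> (enn2real q)) (frac_operator c \<alpha> S)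
            = operator_norm (Lp p) (Lp_norm p) (weak_Lp_norm (enn2real q)) S)"
proof -
  have "sin \<alpha> \<noteq> 0" using assms(1) by (auto simp: sin_zero_iff_int2)
  then have F: "bij_betw (frft_dist c \<alpha>) (tempered_distributions :: 'n functional set) tempered_distributions"
    using assms(2) by (rule bij_betw_frft_dist)
  have sub: "Lp r \<subseteq> (tempered_distributions :: 'n functional set)"
    "weak_Lp t \<subseteq> (tempered_distributions :: 'n functional set)" for r t
    by (auto simp: Lp_def weak_Lp_def)
  \<comment> \<open>The strong and the weak statement differ only in the target space and its norm,
    so both are instances of the same conjugation.\<close>
  note conj = bounded_operator_conjugate[OF F] operator_norm_conjugate[OF F]
  show ?thesis
    unfolding Lp_pullback_def Lp_pullback_norm_def[abs_def] weak_Lp_pullback_def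
      weak_Lp_pullback_norm_def[abs_def] frac_operator_def frft_dist_inv_def
    using conj[OF sub(1) sub(1)] conj[OF sub(1) sub(2)] by blast
qed

end
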